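(* Let $\Gamma=N\rtimes_\sigma H$ with $N$ a discrete abelian group and $H$ a finite group of order $\kappa$. Let $\mathsf{f}\in\ell^2(\Gamma)$ with associated $\kappa\times\kappa$ transfer matrix $\mathbf{F}(\xi)$, $\xi\in\widehat N$. The system $\{L_\gamma\mathsf{f}\}_{\gamma\in\Gamma}$ is an orthonormal basis for $\ell^2(\Gamma)$ if and only if the matrix $\mathbf{F}(\xi)$ is unitary for a.e. $\xi\in\widehat{N}$, or equivalently, if and only if $\mathbf{F}^*(\xi)\,\mathcal{T}_\Gamma\mathsf{f}(\xi)=\begin{bmatrix}1&0&\cdots&0\end{bmatrix}^\top$ for a.e. $\xi\in\widehat{N}$.
   Context: Setting: $(N,+)$ is a discrete abelian group, $(H,\cdot)$ is a finite group of order $\kappa$, $\sigma:H\to\mathrm{Aut}(N)$ is a homomorphism, and $\Gamma=N\rtimes_\sigma H$ is the set $N\times H$ with product $(n,h)(m,l)=(n+\sigma(h)(m),hl)$. The left regular representation of $\Gamma$ on the complex Hilbert space $\ell^2(\Gamma)$ is $L_\gamma\mathsf{f}(\eta)=\mathsf{f}(\gamma^{-1}\eta)$. $\widehat{N}$ is the (compact) dual group of $N$, with Haar measure normalized so that the Fourier transform $\widehat{\mathsf{a}}(\xi)=\sum_{n\in N}\mathsf{a}(n)\langle -n,\xi\rangle$, defined for $\mathsf{a}\in\ell^1(N)$, extends to a unitary operator $\ell^2(N)\to L^2(\widehat{N})$. Transfer matrix: for $\mathsf{f}\in\ell^2(\Gamma)$ and $h,l\in H$ put $\mathsf{f}_{h,l}(n):=\mathsf{f}[(0,l)^{-1}(n,h)]$,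 $n\in N$. The transfer matrix of $\mathsf{f}$ is $\mathbf{F}(\xi)=[\,\widehat{\mathsf{f}}_{h,l}(\xi)\,]_{h,l\in H}$ (row index $h$, column index $l$), and $\mathbf{F}^*(\xi)$ is its conjugate transpose. The elements of $H$ are ordered so that the first one is the identity $1_H$. The map $\mathcal{T}_\Gamma:\ell^2(\Gamma)\to L^2(\widehat{N})^\kappa$ is $\mathcal{T}_\Gamma\mathsf{a}=[\,\widehat{\mathsf{a}}_h\,]_{h\in H}$ (a column vector), where $\mathsf{a}_h(n)=\mathsf{a}(n,h)$. *)

theory Defs
  imports "HOL-Analysis.Analysis"
begin

section \<open>The semidirect product and its left regular representation\<close>

text \<open>
  The finite group \<open>H\<close> is a type of class \<^class>\<open>group_add\<close>, which does not presuppose commutativity: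
  \<open>h + l\<close>, \<open>0\<close> and \<open>- h\<close> stand for \<open>hl\<close>, \<open>1\<^sub>H\<close> and \<open>h\<close> inverse.
\<close>

definition aut_action :: "('h::group_add \<Rightarrow> 'n::ab_group_add \<Rightarrow> 'n) \<Rightarrow> bool" where
  "aut_action \<sigma> \<longleftrightarrow>
     (\<forall>h. bij (\<sigma> h) \<and> (\<forall>m n. \<sigma> h (m + n) = \<sigma> h m + \<sigma> h n)) \<and>
     (\<forall>h l. \<sigma> (h + l) = \<sigma> h \<circ> \<sigma> l)"

definition sd_mult ::
    "('h::group_add \<Rightarrow> 'n::ab_group_add \<Rightarrow> 'n) \<Rightarrow> 'n \<times> 'h \<Rightarrow> 'n \<times> 'h \<Rightarrow> 'n \<times> 'h" where
  "sd_mult \<sigma> \<gamma> \<eta> = (fst \<gamma> + \<sigma> (snd \<gamma>) (fst \<eta>), snd \<gamma> + snd \<eta>)"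

definition sd_inv :: "('h::group_add \<Rightarrow> 'n::ab_group_add \<Rightarrow> 'n) \<Rightarrow> 'n \<times> 'h \<Rightarrow> 'n \<times> 'h" where
  "sd_inv \<sigma> \<gamma> = (\<sigma> (- snd \<gamma>) (- fst \<gamma>), - snd \<gamma>)"

lemma aut_action_zero:
  assumes "aut_action \<sigma>"
  shows "\<sigma> 0 n = n"
proof -
  have "\<sigma> 0 (\<sigma> 0 n) = \<sigma> 0 n"
    using assms unfolding aut_action_def by (metis add_0 comp_apply)
  then show ?thesis
    using assms unfolding aut_action_def by (metis bij_pointE)
qed

lemma aut_action_map_zero:
  assumes "aut_action \<sigma>"
  shows "\<sigma> h 0 = 0"
  using assms unfolding aut_action_def by (metis add_cancel_right_right)

lemma aut_action_add:
  assumes "aut_action \<sigma>"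
  shows "\<sigma> h (m + n) = \<sigma> h m + \<sigma> h n" and "\<sigma> (h + l) n = \<sigma> h (\<sigma> l n)"
  using assms unfolding aut_action_def by auto

lemma sd_mult_assoc:
  assumes "aut_action \<sigma>"
  shows "sd_mult \<sigma> (sd_mult \<sigma> \<gamma> \<eta>) \<zeta> = sd_mult \<sigma> \<gamma> (sd_mult \<sigma> \<eta> \<zeta>)"
  by (simp add: sd_mult_def aut_action_add[OF assms] add.assoc)

lemma sd_mult_one:
  assumes "aut_action \<sigma>"
  shows "sd_mult \<sigma> (0, 0) \<gamma> = \<gamma>" and "sd_mult \<sigma> \<gamma> (0, 0) = \<gamma>"
  by (simp_all add: sd_mult_def aut_action_zero[OF assms] aut_action_map_zero[OF assms])

lemma sd_mult_inv:
  assumes "aut_action \<sigma>"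
  shows "sd_mult \<sigma> (sd_inv \<sigma> \<gamma>) \<gamma> = (0, 0)" and "sd_mult \<sigma> \<gamma> (sd_inv \<sigma> \<gamma>) = (0, 0)"
proof -
  show "sd_mult \<sigma> (sd_inv \<sigma> \<gamma>) \<gamma> = (0, 0)"
    by (simp add: sd_mult_def sd_inv_def aut_action_add(1)[OF assms, symmetric]
        aut_action_map_zero[OF assms])
  show "sd_mult \<sigma> \<gamma> (sd_inv \<sigma> \<gamma>) = (0, 0)"
    by (simp add: sd_mult_def sd_inv_def aut_action_add(2)[OF assms, symmetric]
        aut_action_zero[OF assms])
qed

definition left_regular ::
    "('h::group_add \<Rightarrow> 'n::ab_group_add \<Rightarrow> 'n) \<Rightarrow> 'n \<times> 'h \<Rightarrow>
     ('n \<times> 'h \<Rightarrow> complex) \<Rightarrow> 'n \<times> 'h \<Rightarrow> complex" where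
  "left_regular \<sigma> \<gamma> f = (\<lambda>\<eta>. f (sd_mult \<sigma> (sd_inv \<sigma> \<gamma>) \<eta>))"


section \<open>The Hilbert space of square-summable functions\<close>

definition ell2 :: "('a \<Rightarrow> complex) set" where
  "ell2 = {f. (\<lambda>x. (cmod (f x))\<^sup>2) summable_on UNIV}"

definition ell2_inner :: "('a \<Rightarrow> complex) \<Rightarrow> ('a \<Rightarrow> complex) \<Rightarrow> complex" where
  "ell2_inner f g = (\<Sum>\<^sub>\<infinity>x. f x * cnj (g x))"

definition ell2_norm :: "('a \<Rightarrow> complex) \<Rightarrow> real" where
  "ell2_norm f = sqrt (\<Sum>\<^sub>\<infinity>x. (cmod (f x))\<^sup>2)"

definition ell2_orthonormal_basis :: "('i \<Rightarrow> 'a \<Rightarrow> complex) \<Rightarrow> bool" where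
  "ell2_orthonormal_basis e \<longleftrightarrow>
     (\<forall>i. e i \<in> ell2) \<and>
     (\<forall>i j. ell2_inner (e i) (e j) = (if i = j then 1 else 0)) \<and>
     (\<forall>g\<in>ell2. \<forall>\<epsilon>>0. \<exists>A c. finite A \<and> ell2_norm (\<lambda>x. g x - (\<Sum>i\<in>A. c i * e i x)) < \<epsilon>)"


section \<open>The dual group and the Fourier transform\<close>

text \<open>
  A character \<open>\<xi>\<close> is the function \<open>n \<mapsto> \<langle>n, \<xi>\<rangle>\<close>. As \<open>N\<close> is discrete, every character is
  continuous, and the topology of the dual group is that of pointwise convergence, i.e. the
  subspace topology inherited from the product topology on \<open>'n \<Rightarrow> complex\<close>.
\<close>

definition dual_group :: "('n::ab_group_add \<Rightarrow> complex) set" where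
  "dual_group = {\<xi>. (\<forall>n. cmod (\<xi> n) = 1) \<and> (\<forall>m n. \<xi> (m + n) = \<xi> m * \<xi> n)}"

text \<open>
  Translation-invariant regular Borel measures on the dual group. Total mass one is the
  normalization for which the Fourier transform is unitary; it is forced, because the transform
  of the indicator of \<open>{0}\<close> is the constant function \<open>1\<close>. \<open>N\<close> may be uncountable, so the dual
  group need not be metrizable and regularity has to be required.
\<close>

definition normalized_haar_dual :: "('n::ab_group_add \<Rightarrow> complex) measure \<Rightarrow> bool" where
  "normalized_haar_dual \<mu> \<longleftrightarrow>
     sets \<mu> = sets (restrict_space borel dual_group) \<and>
     (\<forall>\<chi>0\<in>dual_group. \<forall>A\<in>sets \<mu>. emeasure \<mu> ((\<lambda>\<xi> n. \<chi>0 n * \<xi> n) ` A) = emeasure \<mu> A) \<and>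
     (\<forall>A\<in>sets \<mu>. emeasure \<mu> A = (INF U\<in>{U. open U \<and> A \<subseteq> U}. emeasure \<mu> (U \<inter> dual_group))) \<and>
     (\<forall>A\<in>sets \<mu>. emeasure \<mu> A = (SUP K\<in>{K. compact K \<and> K \<subseteq> A}. emeasure \<mu> K)) \<and>
     emeasure \<mu> dual_group = 1"

definition fourier_ell1 :: "('n::ab_group_add \<Rightarrow> complex) \<Rightarrow> ('n \<Rightarrow> complex) \<Rightarrow> complex" where
  "fourier_ell1 a \<xi> = (\<Sum>\<^sub>\<infinity>n. a n * \<xi> (- n))"

definition square_integrable :: "'a measure \<Rightarrow> ('a \<Rightarrow> complex) \<Rightarrow> bool" where
  "square_integrable \<mu> g \<longleftrightarrow> g \<in> borel_measurable \<mu> \<and> integrable \<mu> (\<lambda>\<xi>. (cmod (g \<xi>))\<^sup>2)"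

text \<open>
  The extension to square-summable \<open>a\<close>: the limit in mean square of the transforms of the finite
  truncations of \<open>a\<close>. It is determined up to a null set, and \<open>fourier\<close> picks a representative.
\<close>

definition is_fourier ::
    "('n::ab_group_add \<Rightarrow> complex) measure \<Rightarrow> ('n \<Rightarrow> complex) \<Rightarrow> (('n \<Rightarrow> complex) \<Rightarrow> complex) \<Rightarrow> bool"
  where
  "is_fourier \<mu> a g \<longleftrightarrow>
     square_integrable \<mu> g \<and>
     ((\<lambda>A. \<integral>\<xi>. (cmod (g \<xi> - fourier_ell1 (\<lambda>n. if n \<in> A then a n else 0) \<xi>))\<^sup>2 \<partial>\<mu>) \<longlongrightarrow> 0)
       (finite_subsets_at_top UNIV)"

definition fourier ::
    "('n::ab_group_add \<Rightarrow> complex) measure \<Rightarrow> ('n \<Rightarrow> complex) \<Rightarrow> ('n \<Rightarrow> complex) \<Rightarrow> complex" where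
  "fourier \<mu> a = (SOME g. is_fourier \<mu> a g)"


section \<open>The transfer matrix\<close>

text \<open>Vectors and matrices are indexed by the type of \<open>H\<close> itself; \<open>A $ h $ l\<close> has row index \<open>h\<close>.\<close>

definition transfer_matrix ::
    "('n::ab_group_add \<Rightarrow> complex) measure \<Rightarrow> ('h::{group_add,finite} \<Rightarrow> 'n \<Rightarrow> 'n) \<Rightarrow>
     ('n \<times> 'h \<Rightarrow> complex) \<Rightarrow> ('n \<Rightarrow> complex) \<Rightarrow> ((complex, 'h) vec, 'h) vec" where
  "transfer_matrix \<mu> \<sigma> f \<xi> =
     (\<chi> h l. fourier \<mu> (\<lambda>n. f (sd_mult \<sigma> (sd_inv \<sigma> (0, l)) (n, h))) \<xi>)"

definition fourier_vector ::
    "('n::ab_group_add \<Rightarrow> complex) measure \<Rightarrow> ('n \<times> 'h::finite \<Rightarrow> complex) \<Rightarrow>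
     ('n \<Rightarrow> complex) \<Rightarrow> complex ^ 'h" where
  "fourier_vector \<mu> a \<xi> = (\<chi> h. fourier \<mu> (\<lambda>n. a (n, h)) \<xi>)"

definition conj_transpose :: "complex ^ 'n ^ 'm \<Rightarrow> complex ^ 'm ^ 'n" where
  "conj_transpose A = (\<chi> i j. cnj (A $ j $ i))"

definition unitary_matrix :: "complex ^ 'n ^ 'n \<Rightarrow> bool" where
  "unitary_matrix A \<longleftrightarrow> conj_transpose A ** A = mat 1 \<and> A ** conj_transpose A = mat 1"

end

theory Submission
  imports Defs
begin

text \<open>
  Parseval's identity turns the inner product of \<open>L\<^bsub>(0,l)\<^esub> f\<close> and \<open>L\<^bsub>(m,k)\<^esub> f\<close> into the Fourier coefficient
  at \<open>m\<close> of the entry \<open>(k, l)\<close> of \<open>F\<^sup>* F\<close>. As an integrable function on the dual group is determined by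
  its Fourier coefficients, the system is orthonormal iff \<open>F\<^sup>* F = 1\<close> almost everywhere, and since
  \<open>\<langle>L\<^sub>\<gamma> f, L\<^sub>\<eta> f\<rangle>\<close> only depends on \<open>\<gamma>\<close> inverse times \<open>\<eta>\<close>, the first column of this identity suffices.
  Completeness comes for free: the coefficients of a point mass with respect to the system are the
  conjugated values of \<open>f\<close>, each taken once, so its squared distance to the closed span is
  \<open>1 - \<parallel>f\<parallel>\<^sup>2 = 0\<close>.
\<close>

section \<open>Characters separate points\<close>

text \<open>\<open>N\<close> is arbitrary, so its dual need not be metrizable and its Borel sets
  need not be generated by the characters; this shapes the analytic half. Orthogonality of the
  characters requires, for each nonzero \<open>n\<close>, a character whose value at
  \<open>n\<close> is not 1, and Zorn's lemma supplies it. Vanishing Fourier coefficients are tested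
  against multipliers of Urysohn type, then against compact sets by outer regularity, then against
  all Borel sets by inner regularity, always along sequences so that dominated convergence applies.
  The Fourier transform is a limit over the net of all finite truncations: completeness is applied
  to one sequence of them, and a tail estimate carries the limit over to the net.

  The link with the group is the factorization \<open>(m, l) = (m, 0)(0, l)\<close>. The factor
  \<open>(m, 0)\<close> only translates the functions behind a column of the transfer matrix, which
  multiplies their transforms by a character value. Hence the inner products over the whole group
  turn into Fourier coefficients of finitely many functions.\<close>

primrec mult_of :: "nat \<Rightarrow> 'a::ab_group_add \<Rightarrow> 'a" where
  "mult_of 0 x = 0"
| "mult_of (Suc k) x = x + mult_of k x"

lemma mult_of_add: "mult_of (j + k) x = mult_of j x + mult_of k x"
  by (induction j) (auto simp: algebra_simps)

lemma mult_of_mult: "mult_of (j * k) x = mult_of j (mult_of k x)"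
  by (induction j) (auto simp: mult_of_add)

text \<open>The graphs of characters of subgroups, as subsets of the product of the group and the circle.\<close>

definition partial_char :: "('n::ab_group_add \<times> complex) set \<Rightarrow> bool" where
  "partial_char R \<longleftrightarrow> (0, 1) \<in> R \<and>
     (\<forall>m u n v. (m, u) \<in> R \<longrightarrow> (n, v) \<in> R \<longrightarrow> (m + n, u * v) \<in> R) \<and>
     (\<forall>m u. (m, u) \<in> R \<longrightarrow> (- m, inverse u) \<in> R \<and> cmod u = 1) \<and>
     (\<forall>u. (0, u) \<in> R \<longrightarrow> u = 1)"

lemma partial_charD:
  assumes "partial_char R"
  shows "(0, 1) \<in> R"
    and "(m, u) \<in> R \<Longrightarrow> (n, v) \<in> R \<Longrightarrow> (m + n, u * v) \<in> R"
    and "(m, u) \<in> R \<Longrightarrow> (- m, inverse u) \<in> R"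
    and "(m, u) \<in> R \<Longrightarrow> cmod u = 1"
    and "(0, u) \<in> R \<Longrightarrow> u = 1"
  using assms unfolding partial_char_def by blast+

text \<open>Single-valuedness is demanded only at \<open>0\<close>; the group structure of the graph
  transports it to every point by taking a quotient.\<close>

lemma partial_char_unique:
  assumes "partial_char R" "(m, u) \<in> R" "(m, v) \<in> R"
  shows "u = v"
proof -
  have "(m + - m, u * inverse v) \<in> R"
    using assms partial_charD(2,3) by blast
  then have "u * inverse v = 1"
    using partial_charD(5)[OF assms(1)] by simp
  moreover have "v \<noteq> 0"
    using partial_charD(4)[OF assms(1,3)] by auto
  ultimately show ?thesis
    by (simp add: field_simps)
qed

lemma partial_char_mult_of:
  assumes "partial_char R" "(m, u) \<in> R"
  shows "(mult_of k m, u ^ k) \<in> R"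
  by (induction k) (use assms partial_charD in auto)

text \<open>A value \<open>z\<close> at the new point \<open>x\<close> must agree with what
  \<open>R\<close> already prescribes on multiples of \<open>x\<close>. Either \<open>R\<close>
  prescribes nothing beyond \<open>k = 0\<close>, or everything is determined by the smallest
  positive multiple in the domain, and \<open>z\<close> is a root of the value there. The condition
  \<open>z \<noteq> 1\<close> is what later separates \<open>x\<close> from
  \<open>0\<close>.\<close>

lemma partial_char_root:
  fixes x :: "'n::ab_group_add"
  assumes R: "partial_char R" and x: "x \<notin> Domain R"
  obtains z where "cmod z = 1" "z \<noteq> 1" "\<And>k u. (mult_of k x, u) \<in> R \<Longrightarrow> u = z ^ k"
proof (cases "\<exists>k>0. mult_of k x \<in> Domain R")
  case False
  \<comment> \<open>Only \<open>k = 0\<close> puts the multiple into the domain, so any unimodular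
    number other than 1 could serve as \<open>z\<close>; \<open>-1\<close> is picked.\<close>
  have "u = (-1) ^ k" if "(mult_of k x, u) \<in> R" for k u
  proof -
    have "k = 0"
      using False that by (metis Domain.DomainI gr0I)
    then show ?thesis
      using that partial_charD(5)[OF R] by simp
  qed
  then show ?thesis
    using that[of "-1"] by simp
next
  case True
  \<comment> \<open>The order of \<open>x\<close> modulo the subgroup \<open>Domain R\<close>; it is
    at least 2 because \<open>x\<close> lies outside.\<close>
  define d where "d = (LEAST k. 0 < k \<and> mult_of k x \<in> Domain R)"
  have d: "0 < d" "mult_of d x \<in> Domain R"
    using LeastI_ex[OF True] unfolding d_def by auto
  have least: "d \<le> k" if "0 < k" "mult_of k x \<in> Domain R" for k
    unfolding d_def by (rule Least_le) (use that in auto)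
  have "d \<noteq> 1"
    using d(2) x by auto
  then have d2: "2 \<le> d"
    using d(1) by linarith
  obtain w where w: "(mult_of d x, w) \<in> R"
    using d(2) by auto
  have cw: "cmod w = 1"
    using partial_charD(4)[OF R w] .
  \<comment> \<open>With at least two distinct \<open>d\<close>-th roots of \<open>w\<close>
    available, one of them differs from 1.\<close>
  have "card {z. z ^ d = w} = d"
    by (rule card_nth_roots) (use cw d(1) in auto)
  then have "\<not> {z. z ^ d = w} \<subseteq> {1}"
    using d2 card_mono[of "{1::complex}" "{z. z ^ d = w}"] by auto
  then obtain z where z: "z ^ d = w" "z \<noteq> 1"
    by auto
  have "cmod z ^ d = 1"
    using z(1) cw norm_power[of z d] by simp
  then have cz: "cmod z = 1"
    using power_eq_imp_eq_base[of "cmod z" d 1] d(1) by simp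
  have "u = z ^ k" if ku: "(mult_of k x, u) \<in> R" for k u
  proof -
    \<comment> \<open>Division with remainder: the multiple by \<open>r\<close> is again in the
      domain, so minimality of \<open>d\<close> forces \<open>r = 0\<close>.\<close>
    define q r where "q = k div d" and "r = k mod d"
    have k: "k = q * d + r"
      unfolding q_def r_def by (rule div_mult_mod_eq[symmetric])
    have "(mult_of k x + - mult_of q (mult_of d x), u * inverse (w ^ q)) \<in> R"
      by (intro partial_charD(2,3)[OF R] ku partial_char_mult_of[OF R w])
    moreover have "mult_of k x + - mult_of q (mult_of d x) = mult_of r x"
      unfolding k mult_of_add mult_of_mult by simp
    ultimately have "mult_of r x \<in> Domain R"
      by auto
    moreover have "r < d"
      unfolding r_def using d(1) by simp
    ultimately have "r = 0"
      using least[of r] by (cases "r = 0") auto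
    then have "(mult_of k x, w ^ q) \<in> R"
      using partial_char_mult_of[OF R w, of q] unfolding k mult_of_add mult_of_mult by simp
    then have "u = w ^ q"
      using partial_char_unique[OF R] ku by blast
    then show ?thesis
      unfolding k \<open>r = 0\<close> by (metis add.right_neutral mult.commute power_mult z(1))
  qed
  then show ?thesis
    by (rule that[OF cz z(2)])
qed

text \<open>The extension lives on the subgroup generated by the old domain and \<open>x\<close>. It
  is consistent because \<open>z\<close> respects every value that \<open>R\<close> prescribes on
  multiples of \<open>x\<close>.\<close>

lemma partial_char_extend:
  fixes x :: "'n::ab_group_add"
  assumes R: "partial_char R" and x: "x \<notin> Domain R"
  obtains z R' where "partial_char R'" "R \<subseteq> R'" "(x, z) \<in> R'" "z \<noteq> 1"
proof -
  obtain z where cz: "cmod z = 1" and z1: "z \<noteq> 1"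
    and zk: "\<And>k u. (mult_of k x, u) \<in> R \<Longrightarrow> u = z ^ k"
    using partial_char_root[OF assms] by blast
  have z0: "z \<noteq> 0"
    using cz by auto
  \<comment> \<open>An integer multiple of \<open>x\<close> is written as a difference of two
    natural multiples, since \<open>mult_of\<close> takes natural numbers only.\<close>
  define R' where "R' = {(m + mult_of a x - mult_of b x, u * z ^ a * inverse z ^ b) | m u a b. (m, u) \<in> R}"
  have I: "(p, w) \<in> R'" if "(m, u) \<in> R" "p = m + mult_of a x - mult_of b x"
      "w = u * z ^ a * inverse z ^ b" for m u a b p w
    using that unfolding R'_def by blast
  have "R \<subseteq> R'"
    using I[where a=0 and b=0] by auto
  moreover have "(x, z) \<in> R'"
    using I[OF partial_charD(1)[OF R], where a=1 and b=0] by auto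
  moreover have "partial_char R'"
    unfolding partial_char_def
  proof (intro conjI allI impI)
    show "(0, 1) \<in> R'"
      using \<open>R \<subseteq> R'\<close> partial_charD(1)[OF R] by blast
  next
    fix m u n v
    assume "(m, u) \<in> R'" "(n, v) \<in> R'"
    then obtain m' u' a b n' v' c d where e: "(m', u') \<in> R" "(n', v') \<in> R"
      "m = m' + mult_of a x - mult_of b x" "u = u' * z ^ a * inverse z ^ b"
      "n = n' + mult_of c x - mult_of d x" "v = v' * z ^ c * inverse z ^ d"
      unfolding R'_def by blast
    show "(m + n, u * v) \<in> R'"
      by (rule I[OF partial_charD(2)[OF R e(1,2)], where a = "a + c" and b = "b + d"])
        (simp_all add: e(3-) mult_of_add power_add algebra_simps)
  next
    fix m u
    assume "(m, u) \<in> R'"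
    then obtain m' u' a b where e: "(m', u') \<in> R"
      "m = m' + mult_of a x - mult_of b x" "u = u' * z ^ a * inverse z ^ b"
      unfolding R'_def by blast
    show "(- m, inverse u) \<in> R'"
      by (rule I[OF partial_charD(3)[OF R e(1)], where a = b and b = a])
        (simp_all add: e(2-) mult_ac power_inverse)
    show "cmod u = 1"
      using partial_charD(4)[OF R e(1)] cz by (simp add: e norm_mult norm_power norm_inverse)
  next
    fix w
    assume "(0, w) \<in> R'"
    then obtain m u a b where e: "(m, u) \<in> R" 
      "0 = m + mult_of a x - mult_of b x" "w = u * z ^ a * inverse z ^ b"
      unfolding R'_def by blast
    have u0: "u \<noteq> 0"
      using partial_charD(4)[OF R e(1)] by auto
    \<comment> \<open>According to the sign of \<open>a - b\<close>, either \<open>- m\<close> or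
      \<open>m\<close> is a natural multiple of \<open>x\<close>, and \<open>zk\<close> identifies
      its value as a power of \<open>z\<close>, which cancels.\<close>
    show "w = 1"
    proof (cases "b \<le> a")
      case True
      then obtain c where a: "a = b + c"
        using le_Suc_ex by blast
      have "- m = mult_of c x"
        using e(2) unfolding a mult_of_add by (simp add: algebra_simps add_eq_0_iff)
      then have "inverse u = z ^ c"
        using zk partial_charD(3)[OF R e(1)] by metis
      then show ?thesis
        unfolding e(3) a using u0 z0 by (simp add: field_simps power_add)
    next
      case False
      then obtain c where b: "b = a + c"
        using le_Suc_ex nat_le_linear by blast
      have "m = mult_of c x"
        using e(2) unfolding b mult_of_add by (simp add: algebra_simps)
      then have "u = z ^ c"
        using zk e(1) by metis
      then show ?thesis
        unfolding e(3) b using u0 z0 by (simp add: field_simps power_add)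
    qed
  qed
  ultimately show ?thesis
    using that z1 by blast
qed

text \<open>The trivial character of \<open>{0}\<close> is extended to \<open>x\<close> with a value
  other than 1 before Zorn's lemma is applied above this extension, so a maximal extension keeps
  that value.\<close>

lemma dual_group_separates:
  fixes x :: "'n::ab_group_add"
  assumes "x \<noteq> 0"
  obtains \<omega> where "\<omega> \<in> dual_group" "\<omega> x \<noteq> 1"
proof -
  have "partial_char {(0::'n, 1)}"
    unfolding partial_char_def by auto
  moreover have "x \<notin> Domain {(0::'n, 1)}"
    using assms by auto
  ultimately obtain z R where R: "partial_char R" and xz: "(x, z) \<in> R" "z \<noteq> 1"
    using partial_char_extend by metis
  define A where "A = {S. partial_char S \<and> R \<subseteq> S}"
  have "\<exists>M\<in>A. \<forall>X\<in>A. M \<subseteq> X \<longrightarrow> X = M"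
  proof (rule subset_Zorn_nonempty)
    show "A \<noteq> {}"
      unfolding A_def using R by blast
  next
    fix C
    assume C: "C \<noteq> {}" "subset.chain A C"
    have CA: "partial_char S" "R \<subseteq> S" if "S \<in> C" for S
      using C(2) that unfolding A_def subset.chain_def by auto
    \<comment> \<open>Closure under products involves two pairs, which a chain places in one common
      member.\<close>
    have dir: "\<exists>S\<in>C. p \<in> S \<and> q \<in> S" if "p \<in> \<Union>C" "q \<in> \<Union>C" for p q
      using C(2) that unfolding subset_chain_def by blast
    have "partial_char (\<Union>C)"
      unfolding partial_char_def
    proof (intro conjI allI impI)
      show "(0, 1) \<in> \<Union>C"
        using C(1) CA partial_charD(1) by blast
    next
      fix m u n v
      assume "(m, u) \<in> \<Union>C" "(n, v) \<in> \<Union>C"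
      then show "(m + n, u * v) \<in> \<Union>C"
        using dir CA(1) partial_charD(2) by (metis UnionI)
    next
      fix m u
      assume "(m, u) \<in> \<Union>C"
      then show "(- m, inverse u) \<in> \<Union>C" "cmod u = 1"
        using CA(1) partial_charD(3,4) by blast+
    next
      fix u
      assume "(0, u) \<in> \<Union>C"
      then show "u = 1"
        using CA(1) partial_charD(5) by blast
    qed
    then show "\<Union>C \<in> A"
      unfolding A_def using C(1) CA by blast
  qed
  then obtain M where M: "partial_char M" "R \<subseteq> M"
    and max: "\<And>X. partial_char X \<Longrightarrow> M \<subseteq> X \<Longrightarrow> X = M"
    unfolding A_def by (smt (verit) mem_Collect_eq order_trans)
  \<comment> \<open>A point outside the domain would allow a further extension, against
    maximality.\<close>
  have total: "n \<in> Domain M" for n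
    using partial_char_extend[OF M(1), of n] max by (metis Domain.DomainI)
  define \<omega> where "\<omega> n = (THE u. (n, u) \<in> M)" for n
  have \<omega>: "(n, u) \<in> M \<longleftrightarrow> u = \<omega> n" for n u
  proof -
    obtain v where "(n, v) \<in> M"
      using total[of n] by auto
    then have "\<exists>!u. (n, u) \<in> M"
      using partial_char_unique[OF M(1)] by blast
    then show ?thesis
      unfolding \<omega>_def by (metis theI')
  qed
  have "\<omega> \<in> dual_group"
    unfolding dual_group_def using partial_charD(2,4)[OF M(1)] \<omega> by auto
  moreover have "\<omega> x \<noteq> 1"
    using xz M(2) \<omega> by auto
  ultimately show ?thesis
    by (rule that)
qed

section \<open>Fourier coefficients on the dual group\<close>

lemma open_coordinate_vimage:
  fixes W :: "'b::topological_space set"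
  shows "open W \<Longrightarrow> open ((\<lambda>h :: 'a \<Rightarrow> 'b. h x) -` W)"
  by (intro open_vimage continuous_on_product_coordinates)

text \<open>
  The weaker classes have to come first: so far the library has the separation axioms for function
  types only through their metric, and the arities must stay compatible along the class hierarchy.
\<close>

instance "fun" :: (type, t0_space) t0_space
proof
  fix f g :: "'a \<Rightarrow> 'b"
  assume "f \<noteq> g"
  then obtain x where "f x \<noteq> g x"
    by auto
  then obtain U where "open U" "\<not> (f x \<in> U \<longleftrightarrow> g x \<in> U)"
    using t0_space_class.t0_space by metis
  then show "\<exists>U. open U \<and> \<not> (f \<in> U \<longleftrightarrow> g \<in> U)"
    by (intro exI[of _ "(\<lambda>h. h x) -` U"]) (auto simp: open_coordinate_vimage)
qed

instance "fun" :: (type, t1_space) t1_space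
proof
  fix f g :: "'a \<Rightarrow> 'b"
  assume "f \<noteq> g"
  then obtain x where "f x \<noteq> g x"
    by auto
  then obtain U where "open U" "f x \<in> U" "g x \<notin> U"
    using t1_space by metis
  then show "\<exists>U. open U \<and> f \<in> U \<and> g \<notin> U"
    by (intro exI[of _ "(\<lambda>h. h x) -` U"]) (auto simp: open_coordinate_vimage)
qed

instance "fun" :: (type, t2_space) t2_space
proof
  fix f g :: "'a \<Rightarrow> 'b"
  assume "f \<noteq> g"
  then obtain x where "f x \<noteq> g x"
    by auto
  then obtain U V where "open U" "open V" "f x \<in> U" "g x \<in> V" "U \<inter> V = {}"
    using hausdorff by metis
  then show "\<exists>U V. open U \<and> open V \<and> f \<in> U \<and> g \<in> V \<and> U \<inter> V = {}"
    by (intro exI[of _ "(\<lambda>h. h x) -` U"] exI[of _ "(\<lambda>h. h x) -` V"])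
      (auto simp: open_coordinate_vimage)
qed

section \<open>Algebra and compactness of the dual group\<close>

lemma dual_groupD:
  assumes "\<xi> \<in> dual_group"
  shows "cmod (\<xi> n) = 1" and "\<xi> (m + n) = \<xi> m * \<xi> n" and "\<xi> 0 = 1" and "\<xi> (- n) = cnj (\<xi> n)"
proof -
  show 1: "cmod (\<xi> n) = 1" and 2: "\<xi> (m + n) = \<xi> m * \<xi> n" for m n
    using assms unfolding dual_group_def by auto
  show 3: "\<xi> 0 = 1"
    using 2[of 0 0] 1[of 0] by auto
  have "\<xi> n * \<xi> (- n) = 1"
    using 2[of n "- n"] 3 by simp
  moreover have "\<xi> n * cnj (\<xi> n) = 1"
    using 1[of n] by (simp add: complex_norm_square[symmetric])
  ultimately show "\<xi> (- n) = cnj (\<xi> n)"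
    by (metis mult_cancel_left mult_zero_left zero_neq_one)
qed

lemma dual_group_mult:
  assumes "\<omega> \<in> dual_group" "\<xi> \<in> dual_group"
  shows "(\<lambda>n. \<omega> n * \<xi> n) \<in> dual_group"
  using assms unfolding dual_group_def by (auto simp: norm_mult)

lemma dual_group_cnj:
  assumes "\<omega> \<in> dual_group"
  shows "(\<lambda>n. cnj (\<omega> n)) \<in> dual_group"
  using assms unfolding dual_group_def by auto

lemma continuous_on_coordinate: "continuous_on S (\<lambda>\<xi> :: 'i \<Rightarrow> 'a::topological_space. \<xi> i)"
  by (rule continuous_on_subset[OF continuous_on_product_coordinates]) simp

text \<open>Tychonoff: the homomorphisms form a closed subset of a product of unit circles.\<close>

lemma compact_dual_group: "compact (dual_group :: ('n::ab_group_add \<Rightarrow> complex) set)"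
proof -
  let ?P = "PiE UNIV (\<lambda>_::'n. sphere (0::complex) 1)"
  have "compactin (product_topology (\<lambda>_. euclidean) UNIV) ?P"
    unfolding compactin_PiE by simp
  then have "compact ?P"
    unfolding euclidean_product_topology by simp
  moreover have "closed {\<xi> :: 'n \<Rightarrow> complex. \<forall>m n. \<xi> (m + n) = \<xi> m * \<xi> n}"
    by (intro closed_Collect_all closed_Collect_eq continuous_on_mult continuous_on_coordinate)
  ultimately have "compact (?P \<inter> {\<xi>. \<forall>m n. \<xi> (m + n) = \<xi> m * \<xi> n})"
    by (rule compact_Int_closed)
  also have "?P \<inter> {\<xi>. \<forall>m n. \<xi> (m + n) = \<xi> m * \<xi> n} = dual_group"
    unfolding dual_group_def by (auto simp: PiE_def)
  finally show ?thesis .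
qed

section \<open>Haar measure: measurability, invariance, orthogonality of characters\<close>

locale dual_haar =
  fixes \<mu> :: "('n::ab_group_add \<Rightarrow> complex) measure"
  assumes haar: "normalized_haar_dual \<mu>"
begin

lemma sets_haar: "sets \<mu> = sets (restrict_space borel dual_group)"
  using haar unfolding normalized_haar_dual_def by blast

lemma space_haar: "space \<mu> = dual_group"
  using sets_eq_imp_space_eq[OF sets_haar] by (simp add: space_restrict_space)

lemma emeasure_space_haar: "emeasure \<mu> (space \<mu>) = 1"
  using haar unfolding normalized_haar_dual_def space_haar by blast

sublocale finite_measure \<mu>
  by standard (simp add: emeasure_space_haar)

lemma measure_space_haar: "measure \<mu> (space \<mu>) = 1"
  by (simp add: measure_def emeasure_space_haar)

lemma open_Int_dual_in_sets: "open U \<Longrightarrow> U \<inter> dual_group \<in> sets \<mu>"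
  unfolding sets_haar sets_restrict_space by (auto simp: Int_commute)

lemma compact_in_sets:
  assumes "compact K" "K \<subseteq> dual_group"
  shows "K \<in> sets \<mu>"
proof -
  have "K \<in> sets borel"
    using assms(1) by (simp add: borel_closed compact_imp_closed)
  then have "dual_group \<inter> K \<in> sets \<mu>"
    unfolding sets_haar sets_restrict_space by auto
  then show ?thesis
    using assms(2) by (simp add: Int_absorb1)
qed

lemma continuous_on_dual_measurable:
  "continuous_on dual_group p \<Longrightarrow> p \<in> borel_measurable \<mu>"
  unfolding measurable_cong_sets[OF sets_haar refl] by (rule borel_measurable_continuous_on_restrict)

lemma coordinate_measurable [measurable]: "(\<lambda>\<xi>. \<xi> n) \<in> borel_measurable \<mu>"
  by (intro continuous_on_dual_measurable continuous_on_coordinate)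

lemma integrable_mult_bounded:
  fixes \<phi> \<psi> :: "('n \<Rightarrow> complex) \<Rightarrow> complex"
  assumes "integrable \<mu> \<phi>" "\<psi> \<in> borel_measurable \<mu>" "\<And>\<xi>. \<xi> \<in> dual_group \<Longrightarrow> cmod (\<psi> \<xi>) \<le> B"
  shows "integrable \<mu> (\<lambda>\<xi>. \<psi> \<xi> * \<phi> \<xi>)"
proof (rule Bochner_Integration.integrable_bound)
  show "integrable \<mu> (\<lambda>\<xi>. of_real B * \<phi> \<xi>)"
    using assms(1) by simp
  show "(\<lambda>\<xi>. \<psi> \<xi> * \<phi> \<xi>) \<in> borel_measurable \<mu>"
    using assms(1,2) by simp
  show "AE \<xi> in \<mu>. cmod (\<psi> \<xi> * \<phi> \<xi>) \<le> cmod (of_real B * \<phi> \<xi>)"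
  proof (rule AE_I2)
    fix \<xi> assume "\<xi> \<in> space \<mu>"
    then have "cmod (\<psi> \<xi>) \<le> \<bar>B\<bar>"
      using assms(3)[of \<xi>] unfolding space_haar by linarith
    then show "cmod (\<psi> \<xi> * \<phi> \<xi>) \<le> cmod (of_real B * \<phi> \<xi>)"
      by (simp add: norm_mult mult_right_mono)
  qed
qed

lemma integrable_coordinate: "integrable \<mu> (\<lambda>\<xi>. \<xi> n)"
  by (rule integrable_const_bound[of _ 1]) (auto simp: space_haar dual_groupD(1))

lemma emeasure_translate:
  assumes "\<omega> \<in> dual_group" "A \<in> sets \<mu>"
  shows "emeasure \<mu> ((\<lambda>\<xi> n. \<omega> n * \<xi> n) ` A) = emeasure \<mu> A"
proof -
  have "\<forall>\<omega>\<in>dual_group. \<forall>A\<in>sets \<mu>. emeasure \<mu> ((\<lambda>\<xi> n. \<omega> n * \<xi> n) ` A) = emeasure \<mu> A"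
    using haar by (simp add: normalized_haar_dual_def)
  then show ?thesis
    using assms by simp
qed

lemma integral_translate:
  fixes p :: "('n \<Rightarrow> complex) \<Rightarrow> complex"
  assumes \<omega>: "\<omega> \<in> dual_group" and p: "p \<in> borel_measurable \<mu>"
  shows "(\<integral>\<xi>. p (\<lambda>n. \<omega> n * \<xi> n) \<partial>\<mu>) = (\<integral>\<xi>. p \<xi> \<partial>\<mu>)"
proof -
  let ?T = "\<lambda>\<xi> n. \<omega> n * \<xi> n"
  have "?T \<in> borel_measurable borel"
    by (intro borel_measurable_continuous_onI continuous_on_coordinatewise_then_product
        continuous_on_mult continuous_on_coordinate continuous_on_const)
  then have T: "?T \<in> measurable \<mu> \<mu>"
    unfolding measurable_cong_sets[OF sets_haar sets_haar]
    by (rule measurable_restrict_space3) (use dual_group_mult[OF \<omega>] in auto)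
  have "distr \<mu> \<mu> ?T = \<mu>"
  proof (rule measure_eqI)
    fix A assume "A \<in> sets (distr \<mu> \<mu> ?T)"
    then have A: "A \<in> sets \<mu>"
      by simp
    then have AD: "A \<subseteq> dual_group"
      using sets.sets_into_space space_haar by blast
    have c: "\<omega> n * (cnj (\<omega> n) * z) = z" "cnj (\<omega> n) * (\<omega> n * z) = z" for n z
    proof -
      have "\<omega> n * cnj (\<omega> n) = 1"
        using dual_groupD(1)[OF \<omega>, of n] complex_norm_square[of "\<omega> n"] by simp
      then show "\<omega> n * (cnj (\<omega> n) * z) = z" "cnj (\<omega> n) * (\<omega> n * z) = z"
        by (metis mult.assoc mult.commute mult_1)+
    qed
    \<comment> \<open>Invariance is given for images, while the image measure asks for preimages:
      the preimage under \<open>\<omega>\<close> is the image under its conjugate.\<close>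
    have "?T -` A \<inter> space \<mu> = (\<lambda>\<xi> n. cnj (\<omega> n) * \<xi> n) ` A"
    proof (intro equalityI subsetI)
      fix \<xi> assume "\<xi> \<in> ?T -` A \<inter> space \<mu>"
      then show "\<xi> \<in> (\<lambda>\<xi> n. cnj (\<omega> n) * \<xi> n) ` A"
        by (intro image_eqI[of _ _ "?T \<xi>"]) (auto simp: c)
    next
      fix \<xi> assume "\<xi> \<in> (\<lambda>\<xi> n. cnj (\<omega> n) * \<xi> n) ` A"
      then show "\<xi> \<in> ?T -` A \<inter> space \<mu>"
        using AD dual_group_mult[OF dual_group_cnj[OF \<omega>]] by (auto simp: c space_haar)
    qed
    moreover have "emeasure \<mu> ((\<lambda>\<xi> n. cnj (\<omega> n) * \<xi> n) ` A) = emeasure \<mu> A"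
      using dual_group_cnj[OF \<omega>] A by (rule emeasure_translate)
    ultimately show "emeasure (distr \<mu> \<mu> ?T) A = emeasure \<mu> A"
      using A T by (simp add: emeasure_distr)
  qed simp
  then have "(\<integral>\<xi>. p \<xi> \<partial>\<mu>) = (\<integral>\<xi>. p \<xi> \<partial>distr \<mu> \<mu> ?T)"
    by simp
  also have "\<dots> = (\<integral>\<xi>. p (?T \<xi>) \<partial>\<mu>)"
    by (rule integral_distr[OF T p])
  finally show ?thesis
    by simp
qed

text \<open>Translation by \<open>\<omega>\<close> multiplies the integral by
  \<open>\<omega> n\<close> and leaves it unchanged. If \<open>\<omega> n \<noteq> 1\<close>, it
  must vanish.\<close>

lemma integral_coordinate: "(\<integral>\<xi>. \<xi> n \<partial>\<mu>) = (if n = 0 then 1 else 0)"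
proof (cases "n = 0")
  case True
  have "(\<integral>\<xi>. \<xi> n \<partial>\<mu>) = (\<integral>\<xi>. 1 \<partial>\<mu>)"
    by (rule Bochner_Integration.integral_cong) (auto simp: True space_haar dual_groupD(3))
  then show ?thesis
    using True measure_space_haar by simp
next
  case False
  then obtain \<omega> where \<omega>: "\<omega> \<in> dual_group" "\<omega> n \<noteq> 1"
    by (rule dual_group_separates)
  have "(\<integral>\<xi>. \<omega> n * \<xi> n \<partial>\<mu>) = (\<integral>\<xi>. \<xi> n \<partial>\<mu>)"
    by (rule integral_translate[OF \<omega>(1) coordinate_measurable])
  then have "\<omega> n * (\<integral>\<xi>. \<xi> n \<partial>\<mu>) = (\<integral>\<xi>. \<xi> n \<partial>\<mu>)"
    by simp
  then show ?thesis
    using \<omega>(2) False by simp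
qed

section \<open>Uniqueness of Fourier coefficients for integrable functions\<close>

definition annihilates_chars :: "(('n \<Rightarrow> complex) \<Rightarrow> complex) \<Rightarrow> bool" where
  "annihilates_chars \<phi> \<longleftrightarrow> integrable \<mu> \<phi> \<and> (\<forall>n. (\<integral>\<xi>. \<phi> \<xi> * \<xi> n \<partial>\<mu>) = 0)"

lemma integrable_mult_char: "integrable \<mu> \<phi> \<Longrightarrow> integrable \<mu> (\<lambda>\<xi>. \<xi> n * \<phi> \<xi>)"
  by (rule integrable_mult_bounded[where B = 1]) (auto simp: dual_groupD(1))

lemma annihilates_chars_add:
  assumes "annihilates_chars \<phi>" "annihilates_chars \<psi>"
  shows "annihilates_chars (\<lambda>\<xi>. \<phi> \<xi> + \<psi> \<xi>)"
proof -
  have "integrable \<mu> (\<lambda>\<xi>. \<phi> \<xi> * \<xi> n)" "integrable \<mu> (\<lambda>\<xi>. \<psi> \<xi> * \<xi> n)" for n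
    using assms integrable_mult_char[of \<phi> n] integrable_mult_char[of \<psi> n]
    unfolding annihilates_chars_def by (simp_all add: mult.commute)
  then show ?thesis
    using assms unfolding annihilates_chars_def by (simp add: distrib_right)
qed

lemma annihilates_chars_cmult:
  assumes "annihilates_chars \<phi>"
  shows "annihilates_chars (\<lambda>\<xi>. c * \<phi> \<xi>)"
  using assms unfolding annihilates_chars_def by (simp add: mult.assoc)

text \<open>Multiplication by a character merely shifts the family of Fourier coefficients.\<close>

lemma annihilates_chars_char:
  assumes "annihilates_chars \<phi>"
  shows "annihilates_chars (\<lambda>\<xi>. \<xi> n * \<phi> \<xi>)"
  unfolding annihilates_chars_def
proof (intro conjI allI)
  show "integrable \<mu> (\<lambda>\<xi>. \<xi> n * \<phi> \<xi>)"
    using assms unfolding annihilates_chars_def by (blast intro: integrable_mult_char)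
next
  fix k
  have "(\<integral>\<xi>. \<xi> n * \<phi> \<xi> * \<xi> k \<partial>\<mu>) = (\<integral>\<xi>. \<phi> \<xi> * \<xi> (n + k) \<partial>\<mu>)"
    by (rule Bochner_Integration.integral_cong) (auto simp: space_haar dual_groupD(2))
  then show "(\<integral>\<xi>. \<xi> n * \<phi> \<xi> * \<xi> k \<partial>\<mu>) = 0"
    using assms unfolding annihilates_chars_def by simp
qed

lemma annihilates_chars_cong:
  assumes "\<And>\<xi>. \<xi> \<in> dual_group \<Longrightarrow> \<phi> \<xi> = \<psi> \<xi>"
  shows "annihilates_chars \<phi> \<longleftrightarrow> annihilates_chars \<psi>"
proof -
  have "integrable \<mu> \<phi> \<longleftrightarrow> integrable \<mu> \<psi>"
    by (rule Bochner_Integration.integrable_cong) (auto simp: space_haar assms)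
  moreover have "(\<integral>\<xi>. \<phi> \<xi> * \<xi> n \<partial>\<mu>) = (\<integral>\<xi>. \<psi> \<xi> * \<xi> n \<partial>\<mu>)" for n
    by (rule Bochner_Integration.integral_cong) (auto simp: space_haar assms)
  ultimately show ?thesis
    unfolding annihilates_chars_def by simp
qed

text \<open>
  The multipliers that preserve the functions without Fourier coefficients. They form an algebra
  containing the real and imaginary parts of the characters, so the Urysohn-type part of the
  Stone--Weierstrass theorem applies to them.
\<close>

definition multipliers :: "(('n \<Rightarrow> complex) \<Rightarrow> real) set" where
  "multipliers = {p. continuous_on dual_group p \<and>
     (\<forall>\<phi>. annihilates_chars \<phi> \<longrightarrow> annihilates_chars (\<lambda>\<xi>. of_real (p \<xi>) * \<phi> \<xi>))}"

text \<open>As \<open>\<xi> (- n)\<close> is the conjugate of \<open>\<xi> n\<close> on the dual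
  group, both parts are linear combinations of two characters, with coefficients
  \<open>1/2, 1/2\<close> and \<open>- \<i> / 2, \<i> / 2\<close>.\<close>

lemma Re_Im_char_multiplier:
  "(\<lambda>\<xi>. Re (\<xi> n)) \<in> multipliers" "(\<lambda>\<xi>. Im (\<xi> n)) \<in> multipliers"
proof -
  have "annihilates_chars (\<lambda>\<xi>. of_real (Re (\<xi> n)) * \<phi> \<xi>)
      \<and> annihilates_chars (\<lambda>\<xi>. of_real (Im (\<xi> n)) * \<phi> \<xi>)" if \<phi>: "annihilates_chars \<phi>" for \<phi>
  proof
    have "annihilates_chars (\<lambda>\<xi>. c * (\<xi> n * \<phi> \<xi>) + d * (\<xi> (- n) * \<phi> \<xi>))" for c d
      by (intro annihilates_chars_add annihilates_chars_cmult annihilates_chars_char \<phi>)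
    note * = this
    show "annihilates_chars (\<lambda>\<xi>. of_real (Re (\<xi> n)) * \<phi> \<xi>)"
      by (rule annihilates_chars_cong[THEN iffD1, OF _ *[of "1/2" "1/2"]])
        (simp add: dual_groupD(4) complex_eq_iff field_simps)
    show "annihilates_chars (\<lambda>\<xi>. of_real (Im (\<xi> n)) * \<phi> \<xi>)"
      by (rule annihilates_chars_cong[THEN iffD1, OF _ *[of "- \<i> / 2" "\<i> / 2"]])
        (simp add: dual_groupD(4) complex_eq_iff field_simps)
  qed
  then show "(\<lambda>\<xi>. Re (\<xi> n)) \<in> multipliers" "(\<lambda>\<xi>. Im (\<xi> n)) \<in> multipliers"
    unfolding multipliers_def by (auto intro!: continuous_intros continuous_on_coordinate)
qed

lemma function_ring_on_multipliers: "function_ring_on multipliers dual_group"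
proof
  show "compact (dual_group :: ('n \<Rightarrow> complex) set)"
    by (rule compact_dual_group)
next
  fix p q :: "('n \<Rightarrow> complex) \<Rightarrow> real"
  assume pq: "p \<in> multipliers" "q \<in> multipliers"
  show "(\<lambda>\<xi>. p \<xi> + q \<xi>) \<in> multipliers"
    using pq annihilates_chars_add unfolding multipliers_def
    by (auto intro!: continuous_intros simp: distrib_right)
  show "(\<lambda>\<xi>. p \<xi> * q \<xi>) \<in> multipliers"
    using pq unfolding multipliers_def
    by (auto intro!: continuous_intros simp: mult.assoc)
next
  fix c :: real
  show "(\<lambda>_. c) \<in> multipliers"
    unfolding multipliers_def using annihilates_chars_cmult by auto
next
  fix \<xi> \<eta> :: "'n \<Rightarrow> complex"
  assume "\<xi> \<noteq> \<eta>"
  then obtain n where "\<xi> n \<noteq> \<eta> n"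
    by auto
  then have "Re (\<xi> n) \<noteq> Re (\<eta> n) \<or> Im (\<xi> n) \<noteq> Im (\<eta> n)"
    by (simp add: complex_eq_iff)
  then show "\<exists>p\<in>multipliers. p \<xi> \<noteq> p \<eta>"
    by (elim disjE) (rule bexI[OF _ Re_Im_char_multiplier(1)] bexI[OF _ Re_Im_char_multiplier(2)],
        assumption)+
qed (simp add: multipliers_def)

section \<open>From multipliers to compact sets and from compact sets to Borel sets\<close>

lemma outer_regular:
  assumes A: "A \<in> sets \<mu>" and e: "0 < e"
  obtains U where "open U" "A \<subseteq> U" "measure \<mu> (U \<inter> dual_group - A) < e"
proof -
  have "(INF U\<in>{U. open U \<and> A \<subseteq> U}. emeasure \<mu> (U \<inter> dual_group)) = emeasure \<mu> A"
    using haar A unfolding normalized_haar_dual_def by simp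
  also have "\<dots> < emeasure \<mu> A + ennreal e"
    using e by (simp add: emeasure_eq_measure ennreal_less_iff flip: ennreal_plus)
  finally obtain U where U: "open U" "A \<subseteq> U"
      and less: "emeasure \<mu> (U \<inter> dual_group) < emeasure \<mu> A + ennreal e"
    unfolding INF_less_iff by auto
  have "A \<subseteq> U \<inter> dual_group"
    using U(2) sets.sets_into_space[OF A] space_haar by auto
  moreover have "measure \<mu> (U \<inter> dual_group) < measure \<mu> A + e"
    using less e by (simp add: emeasure_eq_measure ennreal_less_iff flip: ennreal_plus)
  ultimately have "measure \<mu> (U \<inter> dual_group - A) < e"
    using finite_measure_Diff[OF open_Int_dual_in_sets[OF U(1)] A] by simp
  then show ?thesis
    using that U by blast
qed

lemma inner_regular:
  assumes A: "A \<in> sets \<mu>" and e: "0 < e"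
  obtains K where "compact K" "K \<subseteq> A" "measure \<mu> (A - K) < e"
proof (cases "measure \<mu> A < e")
  \<comment> \<open>\<open>ennreal\<close> sends negative numbers to 0, so the strict inequality of
    the other case would fail for null sets. Here the empty set is already close enough.\<close>
  case True
  then show ?thesis
    using that[of "{}"] by simp
next
  case False
  have "ennreal (measure \<mu> A - e) < emeasure \<mu> A"
    using False e by (simp add: emeasure_eq_measure ennreal_less_iff)
  also have "\<dots> = (SUP K\<in>{K. compact K \<and> K \<subseteq> A}. emeasure \<mu> K)"
    using haar A unfolding normalized_haar_dual_def by blast
  finally obtain K where K: "compact K" "K \<subseteq> A" and less: "ennreal (measure \<mu> A - e) < emeasure \<mu> K"
    unfolding less_SUP_iff by auto
  have "K \<in> sets \<mu>"
    using K sets.sets_into_space[OF A] space_haar by (auto intro: compact_in_sets)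
  moreover have "measure \<mu> A - e < measure \<mu> K"
    using less False by (simp add: emeasure_eq_measure ennreal_less_iff)
  ultimately have "measure \<mu> (A - K) < e"
    using finite_measure_Diff[OF A _ K(2)] by simp
  then show ?thesis
    using that K by blast
qed

text \<open>Borel-Cantelli with a geometric majorant. It turns approximation in measure by
  \<open>(1/2) ^ j\<close> into pointwise convergence almost everywhere.\<close>

lemma AE_eventually_notin:
  assumes "\<And>j. A j \<in> sets \<mu>" "\<And>j. measure \<mu> (A j) < (1/2) ^ j"
  shows "AE \<xi> in \<mu>. eventually (\<lambda>j. \<xi> \<notin> A j) sequentially"
proof -
  have "summable (\<lambda>j. measure \<mu> (A j))"
    by (rule summable_comparison_test'[where g = "\<lambda>j. (1/2) ^ j" and N = 0])
      (use assms(2) in \<open>auto intro: less_imp_le summable_geometric\<close>)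
  then have "AE \<xi> in \<mu>. eventually (\<lambda>j. \<xi> \<in> space \<mu> - A j) sequentially"
    by (intro borel_cantelli_AE1 assms(1)) (simp_all add: less_top[symmetric])
  then show ?thesis
    by (rule AE_mp) (auto elim: eventually_mono)
qed

text \<open>Multipliers with values in the unit interval, nearly 1 on \<open>K\<close> and nearly 0
  off an open set barely larger than \<open>K\<close>, tend to the indicator of \<open>K\<close>
  almost everywhere. Each of them integrates to 0 against \<open>\<phi>\<close>.\<close>

lemma annihilates_chars_compact:
  assumes \<phi>: "annihilates_chars \<phi>" and K: "compact K" "K \<subseteq> dual_group"
  shows "(\<integral>\<xi>\<in>K. \<phi> \<xi> \<partial>\<mu>) = 0"
proof -
  interpret function_ring_on multipliers "dual_group :: ('n \<Rightarrow> complex) set"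
    by (rule function_ring_on_multipliers)
  have Ks: "K \<in> sets \<mu>"
    using K by (rule compact_in_sets)
  have "\<exists>U. open U \<and> K \<subseteq> U \<and> measure \<mu> (U \<inter> dual_group - K) < (1/2) ^ j" for j :: nat
    using outer_regular[OF Ks, of "(1/2) ^ j"] by (metis half_gt_zero zero_less_one zero_less_power)
  then obtain U where U: "\<And>j. open (U j)" "\<And>j. K \<subseteq> U j"
      "\<And>j. measure \<mu> (U j \<inter> dual_group - K) < (1/2) ^ j"
    by metis
  \<comment> \<open>The tolerance must be below 1 for every \<open>j\<close>, hence the double
    \<open>Suc\<close>: it starts at 1/2.\<close>
  have "\<exists>p\<in>multipliers. p ` dual_group \<subseteq> {0..1} \<and> (\<forall>\<xi>\<in>dual_group - U j. p \<xi> < inverse (real (Suc (Suc j))))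
      \<and> (\<forall>\<xi>\<in>K. p \<xi> > 1 - inverse (real (Suc (Suc j))))" for j
  proof (rule two)
    show "closed (dual_group - U j)"
      using U(1) compact_dual_group compact_imp_closed closed_Diff by blast
    show "closed K"
      using K(1) by (rule compact_imp_closed)
    show "inverse (real (Suc (Suc j))) < 1"
      using inverse_less_1_iff[of "real (Suc (Suc j))"] by simp
  qed (use U(2) K in auto)
  then obtain p where p: "\<And>j. p j \<in> multipliers" "\<And>j \<xi>. \<xi> \<in> dual_group \<Longrightarrow> 0 \<le> p j \<xi> \<and> p j \<xi> \<le> 1"
      "\<And>j \<xi>. \<xi> \<in> dual_group \<Longrightarrow> \<xi> \<notin> U j \<Longrightarrow> p j \<xi> < inverse (real (Suc (Suc j)))"
      "\<And>j \<xi>. \<xi> \<in> K \<Longrightarrow> p j \<xi> > 1 - inverse (real (Suc (Suc j)))"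
    by (simp add: image_subset_iff Ball_def Bex_def) metis
  have i\<phi>: "integrable \<mu> \<phi>"
    using \<phi> unfolding annihilates_chars_def by blast
  have lim0: "(\<lambda>j. inverse (real (Suc (Suc j)))) \<longlonglongrightarrow> 0"
    using LIMSEQ_inverse_real_of_nat by (rule LIMSEQ_Suc)
  have lim1: "(\<lambda>j. 1 - inverse (real (Suc (Suc j)))) \<longlonglongrightarrow> 1"
    using tendsto_diff[OF tendsto_const lim0, of 1] by simp
  \<comment> \<open>The integral is the Fourier coefficient at \<open>0\<close>, where every
    character equals 1.\<close>
  have zero: "(\<integral>\<xi>. of_real (p j \<xi>) * \<phi> \<xi> \<partial>\<mu>) = 0" for j
  proof -
    have "annihilates_chars (\<lambda>\<xi>. of_real (p j \<xi>) * \<phi> \<xi>)"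
      using p(1) \<phi> unfolding multipliers_def by blast
    then have "(\<integral>\<xi>. of_real (p j \<xi>) * \<phi> \<xi> * \<xi> 0 \<partial>\<mu>) = 0"
      unfolding annihilates_chars_def by blast
    also have "(\<integral>\<xi>. of_real (p j \<xi>) * \<phi> \<xi> * \<xi> 0 \<partial>\<mu>) = (\<integral>\<xi>. of_real (p j \<xi>) * \<phi> \<xi> \<partial>\<mu>)"
      by (rule Bochner_Integration.integral_cong) (auto simp: space_haar dual_groupD(3))
    finally show ?thesis .
  qed
  have "(\<lambda>j. \<integral>\<xi>. of_real (p j \<xi>) * \<phi> \<xi> \<partial>\<mu>) \<longlonglongrightarrow> (\<integral>\<xi>. indicator K \<xi> *\<^sub>R \<phi> \<xi> \<partial>\<mu>)"
  proof (rule integral_dominated_convergence[where w = "\<lambda>\<xi>. cmod (\<phi> \<xi>)"])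
    show "(\<lambda>\<xi>. indicator K \<xi> *\<^sub>R \<phi> \<xi>) \<in> borel_measurable \<mu>"
      using i\<phi> Ks by simp
    show "(\<lambda>\<xi>. complex_of_real (p j \<xi>) * \<phi> \<xi>) \<in> borel_measurable \<mu>" for j
      using i\<phi> continuous_on_dual_measurable[OF continuous[OF p(1)[of j]]] by simp
    show "integrable \<mu> (\<lambda>\<xi>. cmod (\<phi> \<xi>))"
      using i\<phi> by simp
    show "AE \<xi> in \<mu>. cmod (complex_of_real (p j \<xi>) * \<phi> \<xi>) \<le> cmod (\<phi> \<xi>)" for j
      using p(2)[of _ j] by (intro AE_I2) (auto simp: space_haar norm_mult mult_left_le_one_le)
    \<comment> \<open>Almost every point outside \<open>K\<close> eventually leaves the sets
      \<open>U j\<close>, and from then on \<open>p j\<close> is below the vanishing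
      tolerance.\<close>
    have "AE \<xi> in \<mu>. eventually (\<lambda>j. \<xi> \<notin> U j \<inter> dual_group - K) sequentially"
      using U Ks open_Int_dual_in_sets by (intro AE_eventually_notin) auto
    then show "AE \<xi> in \<mu>. (\<lambda>j. complex_of_real (p j \<xi>) * \<phi> \<xi>) \<longlonglongrightarrow> indicator K \<xi> *\<^sub>R \<phi> \<xi>"
      using AE_space
    proof eventually_elim
      case (elim \<xi>)
      then have \<xi>: "\<xi> \<in> dual_group"
        by (simp add: space_haar)
      have "(\<lambda>j. p j \<xi>) \<longlonglongrightarrow> indicator K \<xi>"
      proof (cases "\<xi> \<in> K")
        case True
        have "(\<lambda>j. p j \<xi>) \<longlonglongrightarrow> 1"
          by (rule tendsto_sandwich[OF _ _ lim1 tendsto_const])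
            (use p(2)[OF \<xi>] p(4)[OF True] in \<open>auto intro!: always_eventually less_imp_le\<close>)
        then show ?thesis
          using True by simp
      next
        case False
        then have "eventually (\<lambda>j. \<xi> \<notin> U j) sequentially"
          using elim(1) \<xi> by simp
        then have "eventually (\<lambda>j. p j \<xi> \<le> inverse (real (Suc (Suc j)))) sequentially"
          by (rule eventually_mono) (use p(3)[OF \<xi>] in \<open>auto intro: less_imp_le\<close>)
        then have "(\<lambda>j. p j \<xi>) \<longlonglongrightarrow> 0"
          by (rule tendsto_sandwich[OF _ _ tendsto_const lim0, rotated])
            (use p(2)[OF \<xi>] in \<open>auto intro!: always_eventually\<close>)
        then show ?thesis
          using False by simp
      qed
      then have "(\<lambda>j. complex_of_real (p j \<xi>) * \<phi> \<xi>) \<longlonglongrightarrow> of_real (indicator K \<xi>) * \<phi> \<xi>"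
        by (intro tendsto_mult tendsto_of_real tendsto_const)
      then show ?case
        by (simp add: scaleR_conv_of_real)
    qed
  qed
  then have "(\<integral>\<xi>. indicator K \<xi> *\<^sub>R \<phi> \<xi> \<partial>\<mu>) = 0"
    unfolding zero by (simp add: LIMSEQ_const_iff)
  then show ?thesis
    unfolding set_lebesgue_integral_def .
qed

text \<open>Inner regularity extends the vanishing of integrals from compact sets to all measurable
  sets, and an integrable function with this property is null.\<close>

lemma annihilates_chars_AE_zero:
  assumes \<phi>: "annihilates_chars \<phi>"
  shows "AE \<xi> in \<mu>. \<phi> \<xi> = 0"
proof (rule density_zero)
  show i\<phi>: "integrable \<mu> \<phi>"
    using \<phi> unfolding annihilates_chars_def by blast
  fix A assume A: "A \<in> sets \<mu>"
  have "\<exists>K. compact K \<and> K \<subseteq> A \<and> measure \<mu> (A - K) < (1/2) ^ j" for j :: nat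
    using inner_regular[OF A, of "(1/2) ^ j"] by (metis half_gt_zero zero_less_one zero_less_power)
  then obtain K where K: "\<And>j. compact (K j)" "\<And>j. K j \<subseteq> A" "\<And>j. measure \<mu> (A - K j) < (1/2) ^ j"
    by metis
  have AD: "A \<subseteq> dual_group"
    using sets.sets_into_space[OF A] space_haar by simp
  have Ks: "K j \<in> sets \<mu>" for j
    by (rule compact_in_sets[OF K(1) order_trans[OF K(2) AD]])
  have zero: "(\<integral>\<xi>. indicator (K j) \<xi> *\<^sub>R \<phi> \<xi> \<partial>\<mu>) = 0" for j
    using annihilates_chars_compact[OF \<phi> K(1)[of j]] K(2)[of j] AD
    unfolding set_lebesgue_integral_def by auto
  have "(\<lambda>j. \<integral>\<xi>. indicator (K j) \<xi> *\<^sub>R \<phi> \<xi> \<partial>\<mu>) \<longlonglongrightarrow> (\<integral>\<xi>. indicator A \<xi> *\<^sub>R \<phi> \<xi> \<partial>\<mu>)"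
  proof (rule integral_dominated_convergence[where w = "\<lambda>\<xi>. cmod (\<phi> \<xi>)"])
    show "(\<lambda>\<xi>. indicator A \<xi> *\<^sub>R \<phi> \<xi>) \<in> borel_measurable \<mu>"
      using i\<phi> A by simp
    show "(\<lambda>\<xi>. indicator (K j) \<xi> *\<^sub>R \<phi> \<xi>) \<in> borel_measurable \<mu>" for j
      using i\<phi> Ks by simp
    show "integrable \<mu> (\<lambda>\<xi>. cmod (\<phi> \<xi>))"
      using i\<phi> by simp
    show "AE \<xi> in \<mu>. cmod (indicator (K j) \<xi> *\<^sub>R \<phi> \<xi>) \<le> cmod (\<phi> \<xi>)" for j
      by (intro AE_I2) (auto simp: indicator_def)
    have "AE \<xi> in \<mu>. eventually (\<lambda>j. \<xi> \<notin> A - K j) sequentially"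
      using K Ks A by (intro AE_eventually_notin) auto
    then show "AE \<xi> in \<mu>. (\<lambda>j. indicator (K j) \<xi> *\<^sub>R \<phi> \<xi>) \<longlonglongrightarrow> indicator A \<xi> *\<^sub>R \<phi> \<xi>"
    proof eventually_elim
      case (elim \<xi>)
      then have "eventually (\<lambda>j. indicator (K j) \<xi> *\<^sub>R \<phi> \<xi> = indicator A \<xi> *\<^sub>R \<phi> \<xi>) sequentially"
        by (rule eventually_mono) (use K(2) in \<open>auto simp: indicator_def\<close>)
      then show ?case
        by (rule tendsto_eventually)
    qed
  qed
  then show "(\<integral>\<xi>\<in>A. \<phi> \<xi> \<partial>\<mu>) = 0"
    unfolding zero set_lebesgue_integral_def by (simp add: LIMSEQ_const_iff)
qed

end

section \<open>Square-integrable functions\<close>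

lemma cmod_add_square_le: "(cmod (a + b))\<^sup>2 \<le> 2 * (cmod a)\<^sup>2 + 2 * (cmod b)\<^sup>2"
proof -
  have "(cmod (a + b))\<^sup>2 \<le> (cmod a + cmod b)\<^sup>2"
    by (intro power_mono norm_triangle_ineq norm_ge_zero)
  also have "\<dots> \<le> 2 * (cmod a)\<^sup>2 + 2 * (cmod b)\<^sup>2"
    using sum_squares_bound[of "cmod a" "cmod b"] by (simp add: power2_sum)
  finally show ?thesis .
qed

lemma square_integrableD:
  assumes "square_integrable M u"
  shows "u \<in> borel_measurable M" and "integrable M (\<lambda>x. (cmod (u x))\<^sup>2)"
  using assms unfolding square_integrable_def by auto

lemma square_integrable_cmult:
  "square_integrable M u \<Longrightarrow> square_integrable M (\<lambda>x. c * u x)"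
  unfolding square_integrable_def by (auto simp: norm_mult power_mult_distrib)

lemma square_integrable_add:
  assumes "square_integrable M u" "square_integrable M v"
  shows "square_integrable M (\<lambda>x. u x + v x)"
proof -
  note [measurable] = square_integrableD(1)[OF assms(1)] square_integrableD(1)[OF assms(2)]
  have "integrable M (\<lambda>x. (cmod (u x + v x))\<^sup>2)"
  proof (rule Bochner_Integration.integrable_bound)
    show "integrable M (\<lambda>x. 2 * (cmod (u x))\<^sup>2 + 2 * (cmod (v x))\<^sup>2)"
      using assms[THEN square_integrableD(2)] by simp
  qed (auto simp: cmod_add_square_le)
  then show ?thesis
    unfolding square_integrable_def by simp
qed

lemma square_integrable_diff:
  assumes "square_integrable M u" "square_integrable M v"
  shows "square_integrable M (\<lambda>x. u x - v x)"
  using square_integrable_add[OF assms(1) square_integrable_cmult[OF assms(2), of "-1"]] by simp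

lemma square_integrable_sum:
  "finite A \<Longrightarrow> (\<And>i. i \<in> A \<Longrightarrow> square_integrable M (u i)) \<Longrightarrow>
     square_integrable M (\<lambda>x. \<Sum>i\<in>A. u i x)"
  by (induction A rule: finite_induct)
    (auto intro: square_integrable_add simp: square_integrable_def[of _ "\<lambda>_. 0"])

lemma integrable_mult_cnj:
  assumes "square_integrable M u" "square_integrable M v"
  shows "integrable M (\<lambda>x. u x * cnj (v x))"
proof (rule Bochner_Integration.integrable_bound)
  note [measurable] = square_integrableD(1)[OF assms(1)] square_integrableD(1)[OF assms(2)]
  show "integrable M (\<lambda>x. (cmod (u x))\<^sup>2 + (cmod (v x))\<^sup>2)"
    using assms[THEN square_integrableD(2)] by simp
  have [measurable]: "cnj \<in> borel_measurable borel"
    by (intro borel_measurable_continuous_onI continuous_on_cnj continuous_on_id)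
  show "(\<lambda>x. u x * cnj (v x)) \<in> borel_measurable M"
    by measurable
  have "cmod (u x * cnj (v x)) \<le> (cmod (u x))\<^sup>2 + (cmod (v x))\<^sup>2" for x
  proof -
    have "2 * cmod (u x) * cmod (v x) \<le> (cmod (u x))\<^sup>2 + (cmod (v x))\<^sup>2"
      by (rule sum_squares_bound)
    moreover have "0 \<le> cmod (u x) * cmod (v x)"
      by simp
    ultimately show ?thesis
      unfolding norm_mult complex_mod_cnj by linarith
  qed
  then show "AE x in M. norm (u x * cnj (v x)) \<le> norm ((cmod (u x))\<^sup>2 + (cmod (v x))\<^sup>2)"
    by simp
qed

lemma L2_Cauchy_Schwarz:
  assumes "square_integrable M u" "square_integrable M v"
  shows "(cmod (\<integral>x. u x * cnj (v x) \<partial>M))\<^sup>2 \<le> (\<integral>x. (cmod (u x))\<^sup>2 \<partial>M) * (\<integral>x. (cmod (v x))\<^sup>2 \<partial>M)"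
proof -
  note [measurable] = square_integrableD(1)[OF assms(1)] square_integrableD(1)[OF assms(2)]
  have eq: "(\<integral>\<^sup>+x. (ennreal (cmod (w x)))\<^sup>2 \<partial>M) = ennreal (\<integral>x. (cmod (w x))\<^sup>2 \<partial>M)"
    if "square_integrable M w" for w
    using square_integrableD(2)[OF that] by (simp add: nn_integral_eq_integral ennreal_power)
  have "ennreal (cmod (\<integral>x. u x * cnj (v x) \<partial>M)) \<le> (\<integral>\<^sup>+x. ennreal (cmod (u x * cnj (v x))) \<partial>M)"
    by (rule integral_norm_bound_ennreal[OF integrable_mult_cnj[OF assms]])
  also have "\<dots> = (\<integral>\<^sup>+x. ennreal (cmod (u x)) * ennreal (cmod (v x)) \<partial>M)"
    by (simp add: norm_mult ennreal_mult)
  finally have "(ennreal (cmod (\<integral>x. u x * cnj (v x) \<partial>M)))\<^sup>2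
      \<le> (\<integral>\<^sup>+x. ennreal (cmod (u x)) * ennreal (cmod (v x)) \<partial>M)\<^sup>2"
    by (rule power_mono) simp
  also have "\<dots> \<le> (\<integral>\<^sup>+x. (ennreal (cmod (u x)))\<^sup>2 \<partial>M) * (\<integral>\<^sup>+x. (ennreal (cmod (v x)))\<^sup>2 \<partial>M)"
    by (rule Cauchy_Schwarz_nn_integral) auto
  also have "\<dots> = ennreal ((\<integral>x. (cmod (u x))\<^sup>2 \<partial>M) * (\<integral>x. (cmod (v x))\<^sup>2 \<partial>M))"
    by (simp add: eq assms ennreal_mult)
  finally show ?thesis
    by (simp add: ennreal_power)
qed

text \<open>The hypothesis concerns the product of the squared norms, so that one factor may stay
  constant while the other tends to 0.\<close>

lemma L2_inner_tendsto_zero: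
  assumes "\<And>i. square_integrable M (u i)" "\<And>i. square_integrable M (v i)"
    and "((\<lambda>i. (\<integral>x. (cmod (u i x))\<^sup>2 \<partial>M) * (\<integral>x. (cmod (v i x))\<^sup>2 \<partial>M)) \<longlongrightarrow> 0) F"
  shows "((\<lambda>i. \<integral>x. u i x * cnj (v i x) \<partial>M) \<longlongrightarrow> 0) F"
proof -
  have "((\<lambda>i. (cmod (\<integral>x. u i x * cnj (v i x) \<partial>M))\<^sup>2) \<longlongrightarrow> 0) F"
    by (rule tendsto_sandwich[OF _ _ tendsto_const assms(3)])
      (auto intro!: always_eventually L2_Cauchy_Schwarz assms(1,2))
  then have "((\<lambda>i. cmod (\<integral>x. u i x * cnj (v i x) \<partial>M)) \<longlongrightarrow> 0) F"
    using tendsto_real_sqrt[where x = 0] by fastforce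
  then show ?thesis
    by (rule tendsto_norm_zero_cancel)
qed

text \<open>Writing \<open>\<langle>s, t\<rangle>\<close> as \<open>\<langle>u, v\<rangle> -
  (\<langle>u - s, v\<rangle> + \<langle>u, v - t\<rangle> - \<langle>u - s, v - t\<rangle>)\<close>
  leaves only error terms that Cauchy-Schwarz controls without a bound on the norms of
  \<open>s\<close> and \<open>t\<close>.\<close>

lemma L2_inner_tendsto:
  assumes "square_integrable M u" "square_integrable M v"
    and "\<And>i. square_integrable M (s i)" "\<And>i. square_integrable M (t i)"
    and lim: "((\<lambda>i. \<integral>x. (cmod (u x - s i x))\<^sup>2 \<partial>M) \<longlongrightarrow> 0) F"
      "((\<lambda>i. \<integral>x. (cmod (v x - t i x))\<^sup>2 \<partial>M) \<longlongrightarrow> 0) F"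
  shows "((\<lambda>i. \<integral>x. s i x * cnj (t i x) \<partial>M) \<longlongrightarrow> (\<integral>x. u x * cnj (v x) \<partial>M)) F"
proof -
  have ds: "square_integrable M (\<lambda>x. u x - s i x)" and dt: "square_integrable M (\<lambda>x. v x - t i x)" for i
    using assms by (auto intro: square_integrable_diff)
  have "((\<lambda>i. \<integral>x. (u x - s i x) * cnj (v x) \<partial>M) \<longlongrightarrow> 0) F"
    by (rule L2_inner_tendsto_zero[OF ds assms(2)]) (rule tendsto_mult_left_zero[OF lim(1)])
  moreover have "((\<lambda>i. \<integral>x. u x * cnj (v x - t i x) \<partial>M) \<longlongrightarrow> 0) F"
    by (rule L2_inner_tendsto_zero[OF assms(1) dt]) (rule tendsto_mult_right_zero[OF lim(2)])
  moreover have "((\<lambda>i. \<integral>x. (u x - s i x) * cnj (v x - t i x) \<partial>M) \<longlongrightarrow> 0) F"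
    by (rule L2_inner_tendsto_zero[OF ds dt]) (rule tendsto_mult_zero[OF lim])
  ultimately have "((\<lambda>i. (\<integral>x. u x * cnj (v x) \<partial>M) - ((\<integral>x. (u x - s i x) * cnj (v x) \<partial>M)
      + (\<integral>x. u x * cnj (v x - t i x) \<partial>M) - (\<integral>x. (u x - s i x) * cnj (v x - t i x) \<partial>M)))
      \<longlongrightarrow> (\<integral>x. u x * cnj (v x) \<partial>M) - (0 + 0 - 0)) F"
    by (intro tendsto_intros)
  moreover have "(\<integral>x. u x * cnj (v x) \<partial>M) - ((\<integral>x. (u x - s i x) * cnj (v x) \<partial>M)
      + (\<integral>x. u x * cnj (v x - t i x) \<partial>M) - (\<integral>x. (u x - s i x) * cnj (v x - t i x) \<partial>M))
      = (\<integral>x. s i x * cnj (t i x) \<partial>M)" for i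
  proof -
    have i: "integrable M (\<lambda>x. u x * cnj (v x))" "integrable M (\<lambda>x. (u x - s i x) * cnj (v x))"
      "integrable M (\<lambda>x. u x * cnj (v x - t i x))" "integrable M (\<lambda>x. (u x - s i x) * cnj (v x - t i x))"
      by (intro integrable_mult_cnj ds dt assms)+
    have "(\<integral>x. s i x * cnj (t i x) \<partial>M) = (\<integral>x. u x * cnj (v x) - ((u x - s i x) * cnj (v x)
        + u x * cnj (v x - t i x) - (u x - s i x) * cnj (v x - t i x)) \<partial>M)"
      by (rule arg_cong[where f = "integral\<^sup>L M"]) (simp add: fun_eq_iff algebra_simps)
    also have "\<dots> = (\<integral>x. u x * cnj (v x) \<partial>M) - (\<integral>x. (u x - s i x) * cnj (v x)
        + u x * cnj (v x - t i x) - (u x - s i x) * cnj (v x - t i x) \<partial>M)"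
      by (intro Bochner_Integration.integral_diff Bochner_Integration.integrable_diff
          Bochner_Integration.integrable_add i)
    also have "(\<integral>x. (u x - s i x) * cnj (v x)
        + u x * cnj (v x - t i x) - (u x - s i x) * cnj (v x - t i x) \<partial>M)
      = (\<integral>x. (u x - s i x) * cnj (v x) + u x * cnj (v x - t i x) \<partial>M)
        - (\<integral>x. (u x - s i x) * cnj (v x - t i x) \<partial>M)"
      by (intro Bochner_Integration.integral_diff Bochner_Integration.integrable_add i)
    also have "(\<integral>x. (u x - s i x) * cnj (v x) + u x * cnj (v x - t i x) \<partial>M)
      = (\<integral>x. (u x - s i x) * cnj (v x) \<partial>M) + (\<integral>x. u x * cnj (v x - t i x) \<partial>M)"
      by (intro Bochner_Integration.integral_add i)
    finally show ?thesis
      by simp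
  qed
  ultimately show ?thesis
    by simp
qed

text \<open>Riesz-Fischer for a rapidly Cauchy sequence: the increments are summable almost
  everywhere, and Fatou's lemma passes the given bound to the pointwise limit.\<close>

lemma L2_complete:
  fixes u :: "nat \<Rightarrow> 'a \<Rightarrow> complex"
  assumes u: "\<And>k. square_integrable M (u k)"
    and Cauchy: "\<And>k m. k \<le> m \<Longrightarrow> (\<integral>x. (cmod (u m x - u k x))\<^sup>2 \<partial>M) \<le> (1/4) ^ k"
  obtains g where "square_integrable M g" "\<And>k. (\<integral>x. (cmod (g x - u k x))\<^sup>2 \<partial>M) \<le> (1/4) ^ k"
proof -
  note [measurable] = square_integrableD(1)[OF u]
  have nn: "(\<integral>\<^sup>+x. ennreal ((cmod (u m x - u k x))\<^sup>2) \<partial>M) \<le> ennreal ((1/4) ^ k)" if "k \<le> m" for k m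
    using Cauchy[OF that] square_integrableD(2)[OF square_integrable_diff[OF u u]]
    by (simp add: nn_integral_eq_integral ennreal_leI)
  \<comment> \<open>The weight \<open>2 ^ k\<close> is half of the available decay: the integral of
    \<open>d k\<close> is still at most \<open>(1/2) ^ k\<close>, hence summable.\<close>
  define d where "d k x = 2 ^ k * (cmod (u (Suc k) x - u k x))\<^sup>2" for k x
  have [measurable]: "d k \<in> borel_measurable M" for k
    unfolding d_def by measurable
  have d0: "0 \<le> d k x" for k x
    unfolding d_def by simp
  have "(\<integral>\<^sup>+x. ennreal (d k x) \<partial>M) \<le> ennreal ((1/2) ^ k)" for k
  proof -
    have "(\<integral>\<^sup>+x. ennreal (d k x) \<partial>M) = ennreal (2 ^ k) * (\<integral>\<^sup>+x. ennreal ((cmod (u (Suc k) x - u k x))\<^sup>2) \<partial>M)"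
      unfolding d_def by (subst nn_integral_cmult[symmetric]) (auto simp: ennreal_mult)
    also have "\<dots> \<le> ennreal (2 ^ k) * ennreal ((1/4) ^ k)"
      by (intro mult_left_mono nn) auto
    also have "\<dots> = ennreal ((1/2) ^ k)"
      by (simp add: ennreal_mult[symmetric] power_mult_distrib[symmetric])
    finally show ?thesis .
  qed
  then have "(\<Sum>k. \<integral>\<^sup>+x. ennreal (d k x) \<partial>M) \<le> (\<Sum>k. ennreal ((1/2) ^ k))"
    by (intro suminf_le) auto
  also have "\<dots> = ennreal (\<Sum>k. (1/2) ^ k)"
    by (intro suminf_ennreal2) (auto simp: summable_geometric)
  finally have "(\<integral>\<^sup>+x. (\<Sum>k. ennreal (d k x)) \<partial>M) \<noteq> \<infinity>"
    by (subst nn_integral_suminf) (auto simp: top_unique)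
  then have "AE x in M. (\<Sum>k. ennreal (d k x)) \<noteq> \<infinity>"
    by (intro nn_integral_PInf_AE) auto
  then have conv: "AE x in M. convergent (\<lambda>k. u k x)"
  proof eventually_elim
    case (elim x)
    then have "summable (\<lambda>k. d k x)"
      using d0 by (intro summable_suminf_not_top) auto
    then have "summable (\<lambda>k. d k x + (1/2) ^ k)"
      by (intro summable_add summable_geometric) auto
    \<comment> \<open>The inequality between arithmetic and geometric mean, with the increment
      scaled by \<open>sqrt (2 ^ k)\<close>, bounds it by the sum of two summable terms.\<close>
    moreover have "norm (u (Suc k) x - u k x) \<le> d k x + (1/2) ^ k" for k
    proof -
      let ?c = "cmod (u (Suc k) x - u k x)"
      have "2 * ?c = 2 * (sqrt (2 ^ k) * ?c) * sqrt ((1/2) ^ k)"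
        by (simp add: real_sqrt_mult[symmetric] power_mult_distrib[symmetric])
      also have "\<dots> \<le> (sqrt (2 ^ k) * ?c)\<^sup>2 + (sqrt ((1/2) ^ k))\<^sup>2"
        by (rule sum_squares_bound)
      also have "\<dots> = d k x + (1/2) ^ k"
        unfolding d_def by (simp add: power_mult_distrib)
      finally show ?thesis
        using norm_ge_zero[of "u (Suc k) x - u k x"] by linarith
    qed
    ultimately have "summable (\<lambda>k. u (Suc k) x - u k x)"
      by (rule summable_comparison_test'[where N = 0])
    then have "convergent (\<lambda>n. u n x - u 0 x)"
      by (simp add: summable_iff_convergent sum_lessThan_telescope[of "\<lambda>k. u k x"])
    then have "convergent (\<lambda>n. (u n x - u 0 x) + u 0 x)"
      by (intro convergent_add convergent_const)
    then show ?case
      by simp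
  qed
  define g where "g x = lim (\<lambda>k. u k x)" for x
  have [measurable]: "g \<in> borel_measurable M"
    unfolding g_def by measurable
  have gk: "(\<integral>\<^sup>+x. ennreal ((cmod (g x - u k x))\<^sup>2) \<partial>M) \<le> ennreal ((1/4) ^ k)" for k
  proof -
    \<comment> \<open>Almost everywhere the integrand is a limit in \<open>m\<close>, so Fatou's
      lemma applies to it as a \<open>liminf\<close>.\<close>
    have "AE x in M. ennreal ((cmod (g x - u k x))\<^sup>2) = liminf (\<lambda>m. ennreal ((cmod (u m x - u k x))\<^sup>2))"
      using conv
    proof eventually_elim
      case (elim x)
      then have "(\<lambda>m. u m x) \<longlonglongrightarrow> g x"
        unfolding g_def by (simp add: convergent_LIMSEQ_iff)
      then have "(\<lambda>m. ennreal ((cmod (u m x - u k x))\<^sup>2)) \<longlonglongrightarrow> ennreal ((cmod (g x - u k x))\<^sup>2)"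
        by (intro tendsto_intros)
      then show ?case
        using lim_imp_Liminf[OF sequentially_bot] by metis
    qed
    then have "(\<integral>\<^sup>+x. ennreal ((cmod (g x - u k x))\<^sup>2) \<partial>M)
        = (\<integral>\<^sup>+x. liminf (\<lambda>m. ennreal ((cmod (u m x - u k x))\<^sup>2)) \<partial>M)"
      by (rule nn_integral_cong_AE)
    also have "\<dots> \<le> liminf (\<lambda>m. \<integral>\<^sup>+x. ennreal ((cmod (u m x - u k x))\<^sup>2) \<partial>M)"
      by (rule nn_integral_liminf) auto
    also have "\<dots> \<le> ennreal ((1/4) ^ k)"
      by (rule Liminf_le) (use nn in \<open>auto intro: eventually_sequentiallyI[of k]\<close>)
    finally show ?thesis .
  qed
  have int: "integrable M (\<lambda>x. (cmod (g x - u k x))\<^sup>2)" for k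
    using le_less_trans[OF gk[of k]] by (intro integrableI_bounded) auto
  have "(\<integral>x. (cmod (g x - u k x))\<^sup>2 \<partial>M) \<le> (1/4) ^ k" for k
    using gk[of k] int[of k] by (simp add: nn_integral_eq_integral)
  moreover have "square_integrable M (\<lambda>x. (g x - u 0 x) + u 0 x)"
    using int[of 0] by (intro square_integrable_add u) (simp add: square_integrable_def)
  then have "square_integrable M g"
    by simp
  ultimately show ?thesis
    using that by blast
qed

section \<open>The Fourier transform and Parseval's identity\<close>

text \<open>\<open>F\<close> carries all but \<open>e\<close> of the total sum; a disjoint finite
  set with more than \<open>e\<close> would make the sum over the union exceed the total.\<close>

lemma ell2_tail:
  assumes "a \<in> ell2" "0 < e"
  obtains F where "finite F" "\<And>B. finite B \<Longrightarrow> B \<inter> F = {} \<Longrightarrow> (\<Sum>x\<in>B. (cmod (a x))\<^sup>2) \<le> e"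
proof -
  have s: "(\<lambda>x. (cmod (a x))\<^sup>2) summable_on UNIV"
    using assms(1) unfolding ell2_def by simp
  obtain F where F: "finite F" "dist (\<Sum>x\<in>F. (cmod (a x))\<^sup>2) (\<Sum>\<^sub>\<infinity>x. (cmod (a x))\<^sup>2) \<le> e"
    using infsum_finite_approximation[OF s assms(2)] by blast
  have "(\<Sum>x\<in>B. (cmod (a x))\<^sup>2) \<le> e" if B: "finite B" "B \<inter> F = {}" for B
  proof -
    have "(\<Sum>x\<in>B \<union> F. (cmod (a x))\<^sup>2) \<le> (\<Sum>\<^sub>\<infinity>x. (cmod (a x))\<^sup>2)"
      using B(1) F(1) s by (intro finite_sum_le_infsum) auto
    then show ?thesis
      using B F by (simp add: sum.union_disjoint dist_real_def)
  qed
  then show ?thesis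
    using that F(1) by blast
qed

lemma ell2_mult_cnj_summable:
  assumes "a \<in> ell2" "b \<in> ell2"
  shows "(\<lambda>x. a x * cnj (b x)) summable_on UNIV"
proof (rule abs_summable_summable, rule summable_on_comparison_test)
  show "(\<lambda>x. (cmod (a x))\<^sup>2 + (cmod (b x))\<^sup>2) summable_on UNIV"
    using assms summable_on_add unfolding ell2_def by auto
  fix x
  have "2 * cmod (a x) * cmod (b x) \<le> (cmod (a x))\<^sup>2 + (cmod (b x))\<^sup>2"
    by (rule sum_squares_bound)
  moreover have "0 \<le> cmod (a x) * cmod (b x)"
    by simp
  ultimately show "norm (a x * cnj (b x)) \<le> (cmod (a x))\<^sup>2 + (cmod (b x))\<^sup>2"
    unfolding norm_mult complex_mod_cnj by linarith
qed simp

lemma fourier_ell1_truncate: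
  assumes "finite A"
  shows "fourier_ell1 (\<lambda>n. if n \<in> A then a n else 0) = (\<lambda>\<xi>. \<Sum>n\<in>A. a n * \<xi> (- n))"
proof
  fix \<xi> :: "'a \<Rightarrow> complex"
  have "fourier_ell1 (\<lambda>n. if n \<in> A then a n else 0) \<xi> = (\<Sum>\<^sub>\<infinity>n\<in>A. a n * \<xi> (- n))"
    unfolding fourier_ell1_def by (rule infsum_cong_neutral) auto
  then show "fourier_ell1 (\<lambda>n. if n \<in> A then a n else 0) \<xi> = (\<Sum>n\<in>A. a n * \<xi> (- n))"
    using assms by simp
qed

context dual_haar
begin

lemma square_integrable_coordinate: "square_integrable \<mu> (\<lambda>\<xi>. \<xi> n)"
  unfolding square_integrable_def
  by (auto intro!: integrable_const_bound[of _ 1] simp: space_haar dual_groupD(1))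

lemma square_integrable_trig: "finite A \<Longrightarrow> square_integrable \<mu> (\<lambda>\<xi>. \<Sum>n\<in>A. a n * \<xi> (- n))"
  by (intro square_integrable_sum square_integrable_cmult square_integrable_coordinate)

lemma trig_inner:
  assumes "finite A"
  shows "(\<integral>\<xi>. (\<Sum>n\<in>A. a n * \<xi> (- n)) * cnj (\<Sum>n\<in>A. b n * \<xi> (- n)) \<partial>\<mu>) = (\<Sum>n\<in>A. a n * cnj (b n))"
proof -
  have "(\<integral>\<xi>. (\<Sum>n\<in>A. a n * \<xi> (- n)) * cnj (\<Sum>n\<in>A. b n * \<xi> (- n)) \<partial>\<mu>)
      = (\<integral>\<xi>. (\<Sum>n\<in>A. \<Sum>m\<in>A. a n * cnj (b m) * \<xi> (m - n)) \<partial>\<mu>)"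
  proof (rule Bochner_Integration.integral_cong[OF refl])
    fix \<xi> assume "\<xi> \<in> space \<mu>"
    then have "\<xi> (m - n) = \<xi> (- n) * cnj (\<xi> (- m))" for m n
      using dual_groupD(2)[of \<xi> m "- n"] dual_groupD(4)[of \<xi> m] by (simp add: space_haar)
    then show "(\<Sum>n\<in>A. a n * \<xi> (- n)) * cnj (\<Sum>n\<in>A. b n * \<xi> (- n))
        = (\<Sum>n\<in>A. \<Sum>m\<in>A. a n * cnj (b m) * \<xi> (m - n))"
      by (simp add: sum_product mult_ac)
  qed
  also have "\<dots> = (\<Sum>n\<in>A. \<Sum>m\<in>A. a n * cnj (b m) * (\<integral>\<xi>. \<xi> (m - n) \<partial>\<mu>))"
    by (simp add: integrable_coordinate)
  also have "\<dots> = (\<Sum>n\<in>A. \<Sum>m\<in>A. if m = n then a n * cnj (b m) else 0)"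
    by (intro sum.cong refl) (simp add: integral_coordinate)
  also have "\<dots> = (\<Sum>n\<in>A. a n * cnj (b n))"
    using assms by simp
  finally show ?thesis .
qed

lemma trig_norm:
  assumes "finite A"
  shows "(\<integral>\<xi>. (cmod (\<Sum>n\<in>A. a n * \<xi> (- n)))\<^sup>2 \<partial>\<mu>) = (\<Sum>n\<in>A. (cmod (a n))\<^sup>2)"
proof -
  have "complex_of_real (\<integral>\<xi>. (cmod (\<Sum>n\<in>A. a n * \<xi> (- n)))\<^sup>2 \<partial>\<mu>)
      = (\<integral>\<xi>. complex_of_real ((cmod (\<Sum>n\<in>A. a n * \<xi> (- n)))\<^sup>2) \<partial>\<mu>)"
    by (rule integral_complex_of_real[symmetric])
  also have "\<dots> = (\<Sum>n\<in>A. a n * cnj (a n))"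
    unfolding complex_norm_square by (rule trig_inner[OF assms])
  also have "\<dots> = complex_of_real (\<Sum>n\<in>A. (cmod (a n))\<^sup>2)"
    by (simp add: complex_norm_square[symmetric])
  finally show ?thesis
    using of_real_eq_iff by blast
qed

lemma trig_norm_diff:
  assumes "finite A" "B \<subseteq> A"
  shows "(\<integral>\<xi>. (cmod ((\<Sum>n\<in>A. a n * \<xi> (- n)) - (\<Sum>n\<in>B. a n * \<xi> (- n))))\<^sup>2 \<partial>\<mu>)
    = (\<Sum>n\<in>A - B. (cmod (a n))\<^sup>2)"
  using trig_norm[of "A - B" a] assms by (simp add: sum_diff)

text \<open>Truncations differ in mean square by the mass of \<open>a\<close> on the difference of
  their index sets, so a sequence that exhausts the mass at rate \<open>(1/4) ^ k\<close> has a
  limit, and every larger finite truncation stays near it.\<close>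

lemma is_fourier_exists:
  assumes a: "a \<in> ell2"
  shows "\<exists>g. is_fourier \<mu> a g"
proof -
  have "\<exists>F. finite F \<and> (\<forall>B. finite B \<longrightarrow> B \<inter> F = {} \<longrightarrow> (\<Sum>x\<in>B. (cmod (a x))\<^sup>2) \<le> (1/4) ^ k)" for k
    using ell2_tail[OF a, of "(1/4) ^ k"] by (metis zero_less_divide_1_iff zero_less_numeral zero_less_power)
  then obtain F where F: "\<And>k. finite (F k)"
      "\<And>k B. finite B \<Longrightarrow> B \<inter> F k = {} \<Longrightarrow> (\<Sum>x\<in>B. (cmod (a x))\<^sup>2) \<le> (1/4) ^ k"
    by metis
  \<comment> \<open>The unions make the index sets increasing, so that \<open>trig_norm_diff\<close>
    applies to any two of them.\<close>
  define G where "G k = (\<Union>j\<le>k. F j)" for k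
  have G: "finite (G k)" "F k \<subseteq> G k" for k
    unfolding G_def using F(1) by auto
  have mono: "G k \<subseteq> G m" if "k \<le> m" for k m
    unfolding G_def using that by force
  let ?t = "\<lambda>A \<xi>. \<Sum>n\<in>A. a n * \<xi> (- n)"
  have tail: "(\<integral>\<xi>. (cmod (?t A \<xi> - ?t (G k) \<xi>))\<^sup>2 \<partial>\<mu>) \<le> (1/4) ^ k" if "finite A" "G k \<subseteq> A" for A k
    unfolding trig_norm_diff[OF that] using that G(2)[of k] by (intro F(2)) auto
  obtain g where g: "square_integrable \<mu> g" "\<And>k. (\<integral>\<xi>. (cmod (g \<xi> - ?t (G k) \<xi>))\<^sup>2 \<partial>\<mu>) \<le> (1/4) ^ k"
    by (rule L2_complete[of \<mu> "\<lambda>k. ?t (G k)"])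
      (simp_all add: square_integrable_trig G(1) tail mono)
  \<comment> \<open>The factor 4 collects two errors of \<open>(1/4) ^ k\<close>, each doubled by
    \<open>cmod_add_square_le\<close>.\<close>
  have near: "(\<integral>\<xi>. (cmod (g \<xi> - ?t A \<xi>))\<^sup>2 \<partial>\<mu>) \<le> 4 * (1/4) ^ k" if A: "finite A" "G k \<subseteq> A" for A k
  proof -
    have sq: "square_integrable \<mu> (\<lambda>\<xi>. g \<xi> - ?t (G k) \<xi>)" "square_integrable \<mu> (\<lambda>\<xi>. ?t A \<xi> - ?t (G k) \<xi>)"
      "square_integrable \<mu> (\<lambda>\<xi>. g \<xi> - ?t A \<xi>)"
      by (intro square_integrable_diff g(1) square_integrable_trig A(1) G(1))+
    have "(\<integral>\<xi>. (cmod (g \<xi> - ?t A \<xi>))\<^sup>2 \<partial>\<mu>)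
        \<le> (\<integral>\<xi>. 2 * (cmod (g \<xi> - ?t (G k) \<xi>))\<^sup>2 + 2 * (cmod (?t A \<xi> - ?t (G k) \<xi>))\<^sup>2 \<partial>\<mu>)"
    proof (rule integral_mono)
      fix \<xi>
      have "(cmod (g \<xi> - ?t A \<xi>))\<^sup>2 = (cmod ((g \<xi> - ?t (G k) \<xi>) + - (?t A \<xi> - ?t (G k) \<xi>)))\<^sup>2"
        by simp
      also have "\<dots> \<le> 2 * (cmod (g \<xi> - ?t (G k) \<xi>))\<^sup>2 + 2 * (cmod (- (?t A \<xi> - ?t (G k) \<xi>)))\<^sup>2"
        by (rule cmod_add_square_le)
      finally show "(cmod (g \<xi> - ?t A \<xi>))\<^sup>2
          \<le> 2 * (cmod (g \<xi> - ?t (G k) \<xi>))\<^sup>2 + 2 * (cmod (?t A \<xi> - ?t (G k) \<xi>))\<^sup>2"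
        unfolding norm_minus_cancel .
    qed (use sq[THEN square_integrableD(2)] in auto)
    also have "\<dots> = 2 * (\<integral>\<xi>. (cmod (g \<xi> - ?t (G k) \<xi>))\<^sup>2 \<partial>\<mu>) + 2 * (\<integral>\<xi>. (cmod (?t A \<xi> - ?t (G k) \<xi>))\<^sup>2 \<partial>\<mu>)"
      using sq[THEN square_integrableD(2)] by simp
    also have "\<dots> \<le> 4 * (1/4) ^ k"
      using g(2)[of k] tail[OF A] by linarith
    finally show ?thesis .
  qed
  have "((\<lambda>A. \<integral>\<xi>. (cmod (g \<xi> - fourier_ell1 (\<lambda>n. if n \<in> A then a n else 0) \<xi>))\<^sup>2 \<partial>\<mu>) \<longlongrightarrow> 0)
       (finite_subsets_at_top UNIV)"
  proof (rule tendstoI)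
    fix e :: real
    assume e: "0 < e"
    have "(\<lambda>k. 4 * (1/4::real) ^ k) \<longlonglongrightarrow> 4 * 0"
      by (intro tendsto_mult tendsto_const LIMSEQ_power_zero) simp
    then have "\<forall>\<^sub>F k in sequentially. 4 * (1/4::real) ^ k < e"
      using e by (intro order_tendstoD(2)[where y = "4 * 0"]) auto
    then obtain k where k: "4 * (1/4::real) ^ k < e"
      using eventually_happens'[OF sequentially_bot] by blast
    have "\<forall>\<^sub>F A in finite_subsets_at_top UNIV. finite A \<and> G k \<subseteq> A"
      unfolding eventually_finite_subsets_at_top using G(1)[of k] by (intro exI[of _ "G k"]) auto
    then show "\<forall>\<^sub>F A in finite_subsets_at_top UNIV. dist
        (\<integral>\<xi>. (cmod (g \<xi> - fourier_ell1 (\<lambda>n. if n \<in> A then a n else 0) \<xi>))\<^sup>2 \<partial>\<mu>) 0 < e"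
    proof eventually_elim
      case (elim A)
      then show ?case
        using near[of A k] k by (simp add: fourier_ell1_truncate)
    qed
  qed
  then show ?thesis
    unfolding is_fourier_def using g(1) by blast
qed

lemma is_fourier_fourier: "a \<in> ell2 \<Longrightarrow> is_fourier \<mu> a (fourier \<mu> a)"
  unfolding fourier_def by (rule someI_ex[OF is_fourier_exists])

lemma is_fourier_iff:
  "is_fourier \<mu> a g \<longleftrightarrow> square_integrable \<mu> g \<and>
     ((\<lambda>A. \<integral>\<xi>. (cmod (g \<xi> - (\<Sum>n\<in>A. a n * \<xi> (- n))))\<^sup>2 \<partial>\<mu>) \<longlongrightarrow> 0) (finite_subsets_at_top UNIV)"
proof -
  have "\<forall>\<^sub>F A in finite_subsets_at_top UNIV.
      (\<integral>\<xi>. (cmod (g \<xi> - fourier_ell1 (\<lambda>n. if n \<in> A then a n else 0) \<xi>))\<^sup>2 \<partial>\<mu>)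
      = (\<integral>\<xi>. (cmod (g \<xi> - (\<Sum>n\<in>A. a n * \<xi> (- n))))\<^sup>2 \<partial>\<mu>)"
    by (rule eventually_finite_subsets_at_top_weakI) (simp add: fourier_ell1_truncate)
  from tendsto_cong[OF this] show ?thesis
    unfolding is_fourier_def by blast
qed

text \<open>Translation permutes the finite index sets cofinally, and
  \<open>cmod (\<xi> k) = 1\<close> keeps the mean-square errors unchanged.\<close>

lemma is_fourier_translate:
  assumes "is_fourier \<mu> a g"
  shows "is_fourier \<mu> (\<lambda>n. a (n + k)) (\<lambda>\<xi>. g \<xi> * \<xi> k)"
proof (rule is_fourier_iff[THEN iffD2], rule conjI)
  have g: "square_integrable \<mu> g"
    using assms unfolding is_fourier_def by blast
  note [measurable] = square_integrableD(1)[OF g]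
  have "integrable \<mu> (\<lambda>\<xi>. (cmod (g \<xi> * \<xi> k))\<^sup>2) \<longleftrightarrow> integrable \<mu> (\<lambda>\<xi>. (cmod (g \<xi>))\<^sup>2)"
    by (rule Bochner_Integration.integrable_cong) (auto simp: space_haar dual_groupD(1) norm_mult)
  then show "square_integrable \<mu> (\<lambda>\<xi>. g \<xi> * \<xi> k)"
    using g unfolding square_integrable_def by simp
  let ?I = "\<lambda>A. \<integral>\<xi>. (cmod (g \<xi> - (\<Sum>n\<in>A. a n * \<xi> (- n))))\<^sup>2 \<partial>\<mu>"
  have "filterlim ((`) (\<lambda>n. n + k)) (finite_subsets_at_top UNIV) (finite_subsets_at_top (UNIV :: 'n set))"
    using filtermap_image_finite_subsets_at_top[of "\<lambda>n. n + k" "UNIV :: 'n set"]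
    by (simp add: filterlim_def surj_plus_right)
  from filterlim_compose[OF is_fourier_iff[THEN iffD1, THEN conjunct2, OF assms] this]
  have "((\<lambda>A. ?I ((\<lambda>n. n + k) ` A)) \<longlongrightarrow> 0) (finite_subsets_at_top UNIV)" .
  moreover have "?I ((\<lambda>n. n + k) ` A) = (\<integral>\<xi>. (cmod (g \<xi> * \<xi> k - (\<Sum>n\<in>A. a (n + k) * \<xi> (- n))))\<^sup>2 \<partial>\<mu>)" for A
  proof (rule Bochner_Integration.integral_cong[OF refl])
    fix \<xi> assume "\<xi> \<in> space \<mu>"
    then have \<xi>: "\<xi> \<in> dual_group"
      by (simp add: space_haar)
    have "\<xi> (- n) = \<xi> (- (n + k)) * \<xi> k" for n
      using dual_groupD(2)[OF \<xi>, of "- (n + k)" k] by simp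
    then have "(\<Sum>n\<in>A. a (n + k) * \<xi> (- n)) = (\<Sum>n\<in>A. a (n + k) * \<xi> (- (n + k))) * \<xi> k"
      by (simp add: sum_distrib_right mult.assoc)
    also have "(\<Sum>n\<in>A. a (n + k) * \<xi> (- (n + k))) = (\<Sum>n\<in>(\<lambda>n. n + k) ` A. a n * \<xi> (- n))"
      by (subst sum.reindex) (auto simp: inj_on_def)
    finally have "cmod (g \<xi> * \<xi> k - (\<Sum>n\<in>A. a (n + k) * \<xi> (- n)))
        = cmod ((g \<xi> - (\<Sum>n\<in>(\<lambda>n. n + k) ` A. a n * \<xi> (- n))) * \<xi> k)"
      by (simp add: left_diff_distrib)
    also have "\<dots> = cmod (g \<xi> - (\<Sum>n\<in>(\<lambda>n. n + k) ` A. a n * \<xi> (- n)))"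
      using dual_groupD(1)[OF \<xi>] by (simp add: norm_mult)
    finally show "(cmod (g \<xi> - (\<Sum>n\<in>(\<lambda>n. n + k) ` A. a n * \<xi> (- n))))\<^sup>2
        = (cmod (g \<xi> * \<xi> k - (\<Sum>n\<in>A. a (n + k) * \<xi> (- n))))\<^sup>2"
      by simp
  qed
  ultimately show "((\<lambda>A. \<integral>\<xi>. (cmod (g \<xi> * \<xi> k - (\<Sum>n\<in>A. a (n + k) * \<xi> (- n))))\<^sup>2 \<partial>\<mu>) \<longlongrightarrow> 0)
      (finite_subsets_at_top UNIV)"
    by simp
qed

text \<open>The identity holds for equal finite truncations by \<open>trig_inner\<close> and
  survives the limit; the limit of the finite sums along the net is the infinite sum by
  definition.\<close>

lemma parseval:
  assumes "a \<in> ell2" "b \<in> ell2" and g: "is_fourier \<mu> a g" and h: "is_fourier \<mu> b h"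
  shows "(\<integral>\<xi>. g \<xi> * cnj (h \<xi>) \<partial>\<mu>) = (\<Sum>\<^sub>\<infinity>n. a n * cnj (b n))"
proof -
  let ?F = "finite_subsets_at_top (UNIV :: 'n set)"
  \<comment> \<open>\<open>L2_inner_tendsto\<close> asks for square integrability at every index,
    including infinite sets, where the value is set to 0.\<close>
  let ?t = "\<lambda>a A \<xi>. if finite A then \<Sum>n\<in>A. a n * \<xi> (- n) else (0::complex)"
  have sq: "square_integrable \<mu> (?t c A)" for c A
    using square_integrable_trig[of A c] by (cases "finite A") (auto simp: square_integrable_def)
  have "((\<lambda>A. \<integral>\<xi>. ?t a A \<xi> * cnj (?t b A \<xi>) \<partial>\<mu>) \<longlongrightarrow> (\<integral>\<xi>. g \<xi> * cnj (h \<xi>) \<partial>\<mu>)) ?F"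
  proof (rule L2_inner_tendsto[OF _ _ sq sq])
    show "square_integrable \<mu> g" "square_integrable \<mu> h"
      using g h unfolding is_fourier_def by blast+
    show "((\<lambda>A. \<integral>\<xi>. (cmod (g \<xi> - ?t a A \<xi>))\<^sup>2 \<partial>\<mu>) \<longlongrightarrow> 0) ?F"
      by (rule Lim_transform_eventually[OF is_fourier_iff[THEN iffD1, THEN conjunct2, OF g]])
        (auto intro: eventually_finite_subsets_at_top_weakI)
    show "((\<lambda>A. \<integral>\<xi>. (cmod (h \<xi> - ?t b A \<xi>))\<^sup>2 \<partial>\<mu>) \<longlongrightarrow> 0) ?F"
      by (rule Lim_transform_eventually[OF is_fourier_iff[THEN iffD1, THEN conjunct2, OF h]])
        (auto intro: eventually_finite_subsets_at_top_weakI)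
  qed
  moreover have "\<forall>\<^sub>F A in ?F. (\<integral>\<xi>. ?t a A \<xi> * cnj (?t b A \<xi>) \<partial>\<mu>) = (\<Sum>n\<in>A. a n * cnj (b n))"
    by (rule eventually_finite_subsets_at_top_weakI) (use trig_inner[of _ a b] in simp)
  ultimately have "((\<lambda>A. \<Sum>n\<in>A. a n * cnj (b n)) \<longlongrightarrow> (\<integral>\<xi>. g \<xi> * cnj (h \<xi>) \<partial>\<mu>)) ?F"
    by (rule Lim_transform_eventually)
  then have "((\<lambda>n. a n * cnj (b n)) has_sum (\<integral>\<xi>. g \<xi> * cnj (h \<xi>) \<partial>\<mu>)) UNIV"
    unfolding has_sum_def .
  then show ?thesis
    by (simp add: infsumI)
qed

end

section \<open>Orthonormal bases of square-summable functions\<close>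

lemma has_sum_finite_sum:
  fixes f :: "'i \<Rightarrow> 'a \<Rightarrow> 'b::topological_comm_monoid_add"
  assumes "finite I" "\<And>i. i \<in> I \<Longrightarrow> (f i has_sum s i) A"
  shows "((\<lambda>x. \<Sum>i\<in>I. f i x) has_sum (\<Sum>i\<in>I. s i)) A"
  using assms by (induction I rule: finite_induct) (auto intro: has_sum_add)

lemma has_sum_only:
  fixes f :: "'a \<Rightarrow> 'b::{comm_monoid_add, topological_space}"
  assumes "\<And>x. x \<noteq> y \<Longrightarrow> f x = 0"
  shows "(f has_sum f y) UNIV"
  using has_sum_cong_neutral[of UNIV "{y}" f f "f y"] assms has_sum_finite[of "{y}" f] by auto

lemma ell2_inner_has_sum:
  "a \<in> ell2 \<Longrightarrow> b \<in> ell2 \<Longrightarrow> ((\<lambda>x. a x * cnj (b x)) has_sum ell2_inner a b) UNIV"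
  unfolding ell2_inner_def by (intro has_sum_infsum ell2_mult_cnj_summable)

lemma norm_sum_square_le:
  assumes "finite B"
  shows "(cmod (\<Sum>y\<in>B. z y))\<^sup>2 \<le> real (card B) * (\<Sum>y\<in>B. (cmod (z y))\<^sup>2)"
proof -
  have "(cmod (\<Sum>y\<in>B. z y))\<^sup>2 \<le> (\<Sum>y\<in>B. cmod (z y))\<^sup>2"
    by (intro power_mono norm_sum norm_ge_zero)
  also have "\<dots> \<le> (\<Sum>y\<in>B. (cmod (z y))\<^sup>2) * real (card B)"
    using sum_squared_le_sum_of_squares[of "\<lambda>y. cmod (z y)" B] assms by simp
  finally show ?thesis
    by (simp add: mult.commute)
qed

text \<open>The subtracted sum is the projection of the point mass at \<open>y\<close> onto the span
  of finitely many \<open>e i\<close>, because its coefficient at \<open>e i\<close> is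
  \<open>cnj (e i y)\<close>. Expanding the square gives Pythagoras.\<close>

lemma has_sum_residual_point_mass:
  assumes e: "\<And>i. e i \<in> ell2"
    and on: "\<And>i j. ell2_inner (e i) (e j) = (if i = j then 1 else 0)"
    and A: "finite A"
  shows "((\<lambda>x. (cmod ((if x = y then 1 else 0) - (\<Sum>i\<in>A. cnj (e i y) * e i x)))\<^sup>2)
    has_sum (1 - (\<Sum>i\<in>A. (cmod (e i y))\<^sup>2))) UNIV"
proof -
  let ?s = "\<lambda>x. \<Sum>i\<in>A. cnj (e i y) * e i x"
  let ?d = "\<lambda>x. if x = y then 1 else (0::complex)"
  let ?S = "\<Sum>i\<in>A. cnj (e i y) * e i y"
  have S: "cnj ?S = ?S" "?S = complex_of_real (\<Sum>i\<in>A. (cmod (e i y))\<^sup>2)"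
  proof -
    have "cnj (e i y) * e i y = complex_of_real ((cmod (e i y))\<^sup>2)" for i
      using complex_norm_square[of "e i y"] by (simp add: mult.commute)
    then show "?S = complex_of_real (\<Sum>i\<in>A. (cmod (e i y))\<^sup>2)"
      by simp
    then show "cnj ?S = ?S"
      by (simp only: complex_cnj_complex_of_real)
  qed
  have ss: "((\<lambda>x. ?s x * cnj (?s x)) has_sum ?S) UNIV"
  proof -
    have "((\<lambda>x. \<Sum>i\<in>A. \<Sum>j\<in>A. cnj (e i y) * e j y * (e i x * cnj (e j x))) has_sum
        (\<Sum>i\<in>A. \<Sum>j\<in>A. cnj (e i y) * e j y * ell2_inner (e i) (e j))) UNIV"
      by (intro has_sum_finite_sum A has_sum_cmult_right ell2_inner_has_sum e)
    moreover have "(\<Sum>i\<in>A. \<Sum>j\<in>A. cnj (e i y) * e j y * ell2_inner (e i) (e j)) = ?S"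
      using A by (simp add: on if_distrib[of "\<lambda>z. _ * z"] cong: if_cong)
    moreover have "?s x * cnj (?s x) = (\<Sum>i\<in>A. \<Sum>j\<in>A. cnj (e i y) * e j y * (e i x * cnj (e j x)))" for x
      by (simp add: sum_product mult_ac)
    ultimately show ?thesis
      by simp
  qed
  have dd: "(?d has_sum 1) UNIV"
    using has_sum_only[of y ?d] by simp
  \<comment> \<open>Both mixed terms live at the single point \<open>y\<close>, and their value
    there is real by \<open>S\<close>, so they contribute equally.\<close>
  have ds: "((\<lambda>x. ?d x * cnj (?s x)) has_sum ?S) UNIV"
    using has_sum_only[of y "\<lambda>x. ?d x * cnj (?s x)"] S(1) by simp
  have sd: "((\<lambda>x. ?s x * ?d x) has_sum ?S) UNIV"
    using has_sum_only[of y "\<lambda>x. ?s x * ?d x"] by simp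
  have "((\<lambda>x. ?d x + ((-1) * (?d x * cnj (?s x)) + ((-1) * (?s x * ?d x) + ?s x * cnj (?s x))))
      has_sum (1 + ((-1) * ?S + ((-1) * ?S + ?S)))) UNIV"
    by (intro has_sum_add has_sum_cmult_right dd ds sd ss)
  moreover have "?d x + ((-1) * (?d x * cnj (?s x)) + ((-1) * (?s x * ?d x) + ?s x * cnj (?s x)))
      = complex_of_real ((cmod (?d x - ?s x))\<^sup>2)" for x
    unfolding complex_norm_square by (simp add: algebra_simps)
  moreover have "1 + ((-1) * ?S + ((-1) * ?S + ?S)) = complex_of_real (1 - (\<Sum>i\<in>A. (cmod (e i y))\<^sup>2))"
    using S(2) by simp
  ultimately have "((\<lambda>x. complex_of_real ((cmod (?d x - ?s x))\<^sup>2)) has_sum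
      complex_of_real (1 - (\<Sum>i\<in>A. (cmod (e i y))\<^sup>2))) UNIV"
    by (simp only:)
  then show ?thesis
    unfolding has_sum_of_real_iff .
qed

text \<open>
  The point masses span a dense subspace, so Parseval's identity is only needed for them.
\<close>

lemma ell2_orthonormal_basisI:
  fixes e :: "'i \<Rightarrow> 'a \<Rightarrow> complex"
  assumes e: "\<And>i. e i \<in> ell2"
    and on: "\<And>i j. ell2_inner (e i) (e j) = (if i = j then 1 else 0)"
    and pm: "\<And>y. ((\<lambda>i. (cmod (e i y))\<^sup>2) has_sum 1) UNIV"
  shows "ell2_orthonormal_basis e"
  unfolding ell2_orthonormal_basis_def
proof (intro conjI allI ballI impI)
  fix g :: "'a \<Rightarrow> complex" and \<epsilon> :: real
  assume g: "g \<in> ell2" and \<epsilon>: "0 < \<epsilon>"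
  \<comment> \<open>Budget: the tail enters doubled and costs \<open>\<epsilon>\<^sup>2 / 4\<close>,
    the residuals on \<open>B\<close> cost less than \<open>\<epsilon>\<^sup>2 / 2\<close>, and the
    total stays below \<open>\<epsilon>\<^sup>2\<close>.\<close>
  obtain B where B: "finite B" "\<And>C. finite C \<Longrightarrow> C \<inter> B = {} \<Longrightarrow> (\<Sum>x\<in>C. (cmod (g x))\<^sup>2) \<le> \<epsilon>\<^sup>2 / 8"
    using ell2_tail[OF g, of "\<epsilon>\<^sup>2 / 8"] \<epsilon> by auto
  let ?r = "\<lambda>A y. 1 - (\<Sum>i\<in>A. (cmod (e i y))\<^sup>2)"
  \<comment> \<open>The bound for the residuals on \<open>B\<close>: the 2 stems from
    \<open>cmod_add_square_le\<close>, the cardinality from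
    \<open>norm_sum_square_le\<close>.\<close>
  let ?R = "\<lambda>A. 2 * (real (card B) * (\<Sum>y\<in>B. (cmod (g y))\<^sup>2 * ?r A y))"
  have "(?R \<longlongrightarrow> 2 * (real (card B) * (\<Sum>y\<in>B. (cmod (g y))\<^sup>2 * (1 - 1)))) (finite_subsets_at_top UNIV)"
    using pm unfolding has_sum_def
    by (intro tendsto_mult tendsto_const tendsto_sum tendsto_diff) auto
  then have "\<forall>\<^sub>F A in finite_subsets_at_top UNIV. ?R A < \<epsilon>\<^sup>2 / 2"
    by (rule order_tendstoD) (use \<epsilon> in simp)
  moreover have "\<forall>\<^sub>F A in finite_subsets_at_top UNIV. finite A"
    by (rule eventually_finite_subsets_at_top_weakI)
  ultimately have "\<forall>\<^sub>F A in finite_subsets_at_top UNIV. ?R A < \<epsilon>\<^sup>2 / 2 \<and> finite A"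
    by (rule eventually_conj)
  then obtain A where A: "?R A < \<epsilon>\<^sup>2 / 2" "finite A"
    using eventually_happens'[OF finite_subsets_at_top_neq_bot] by blast
  \<comment> \<open>The coefficients of \<open>g\<close> restricted to the finite set
    \<open>B\<close>.\<close>
  define c where "c i = (\<Sum>y\<in>B. g y * cnj (e i y))" for i
  define T where "T y x = (if x = y then 1 else 0) - (\<Sum>i\<in>A. cnj (e i y) * e i x)" for y x
  define q where "q x = (if x \<in> B then 0 else g x)" for x
  \<comment> \<open>The error consists of the part of \<open>g\<close> outside \<open>B\<close> and
    the residuals of the point masses in \<open>B\<close>, weighted by the values of
    \<open>g\<close>.\<close>
  have split: "g x - (\<Sum>i\<in>A. c i * e i x) = q x + (\<Sum>y\<in>B. g y * T y x)" for x
  proof -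
    have "(\<Sum>y\<in>B. g y * T y x) = (\<Sum>y\<in>B. g y * (if x = y then 1 else 0)) - (\<Sum>y\<in>B. \<Sum>i\<in>A. g y * (cnj (e i y) * e i x))"
      unfolding T_def by (simp add: right_diff_distrib sum_subtractf sum_distrib_left)
    also have "(\<Sum>y\<in>B. g y * (if x = y then 1 else 0)) = g x - q x"
      using B(1) by (simp add: q_def if_distrib[of "\<lambda>z. _ * z"] cong: if_cong)
    also have "(\<Sum>y\<in>B. \<Sum>i\<in>A. g y * (cnj (e i y) * e i x)) = (\<Sum>i\<in>A. c i * e i x)"
      unfolding c_def by (subst sum.swap) (simp add: sum_distrib_right mult.assoc)
    finally show ?thesis
      by simp
  qed
  have q: "(\<lambda>x. (cmod (q x))\<^sup>2) summable_on UNIV" "(\<Sum>\<^sub>\<infinity>x. (cmod (q x))\<^sup>2) \<le> \<epsilon>\<^sup>2 / 8"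
  proof -
    show s: "(\<lambda>x. (cmod (q x))\<^sup>2) summable_on UNIV"
      by (rule summable_on_comparison_test[of "\<lambda>x. (cmod (g x))\<^sup>2"])
        (use g in \<open>auto simp: ell2_def q_def\<close>)
    show "(\<Sum>\<^sub>\<infinity>x. (cmod (q x))\<^sup>2) \<le> \<epsilon>\<^sup>2 / 8"
    proof (rule infsum_le_finite_sums[OF s])
      fix F :: "'a set" assume F: "finite F"
      have "(\<Sum>x\<in>F. (cmod (q x))\<^sup>2) = (\<Sum>x\<in>F - B. (cmod (g x))\<^sup>2)"
        by (rule sum.mono_neutral_cong_right) (auto simp: q_def F)
      also have "\<dots> \<le> \<epsilon>\<^sup>2 / 8"
        by (rule B(2)) (use F in auto)
      finally show "(\<Sum>x\<in>F. (cmod (q x))\<^sup>2) \<le> \<epsilon>\<^sup>2 / 8" .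
    qed
  qed
  let ?b = "\<lambda>x. 2 * (cmod (q x))\<^sup>2 + 2 * (real (card B) * (\<Sum>y\<in>B. (cmod (g y))\<^sup>2 * (cmod (T y x))\<^sup>2))"
  have "(?b has_sum (2 * (\<Sum>\<^sub>\<infinity>x. (cmod (q x))\<^sup>2) + ?R A)) UNIV"
    unfolding T_def
    by (intro has_sum_add has_sum_cmult_right has_sum_finite_sum has_sum_infsum q(1) B(1)
        has_sum_residual_point_mass e on A(2))
  then have b: "?b summable_on UNIV" "infsum ?b UNIV \<le> 2 * (\<epsilon>\<^sup>2 / 8) + ?R A"
    using q(2) by (auto simp: infsumI has_sum_imp_summable)
  have le: "(cmod (g x - (\<Sum>i\<in>A. c i * e i x)))\<^sup>2 \<le> ?b x" for x
  proof -
    have "(cmod (g x - (\<Sum>i\<in>A. c i * e i x)))\<^sup>2 \<le> 2 * (cmod (q x))\<^sup>2 + 2 * (cmod (\<Sum>y\<in>B. g y * T y x))\<^sup>2"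
      unfolding split by (rule cmod_add_square_le)
    also have "(cmod (\<Sum>y\<in>B. g y * T y x))\<^sup>2 \<le> real (card B) * (\<Sum>y\<in>B. (cmod (g y * T y x))\<^sup>2)"
      by (rule norm_sum_square_le[OF B(1)])
    finally show ?thesis
      by (simp add: norm_mult power_mult_distrib)
  qed
  have "(\<lambda>x. (cmod (g x - (\<Sum>i\<in>A. c i * e i x)))\<^sup>2) summable_on UNIV"
    by (rule summable_on_comparison_test[OF b(1)]) (use le in auto)
  then have "(\<Sum>\<^sub>\<infinity>x. (cmod (g x - (\<Sum>i\<in>A. c i * e i x)))\<^sup>2) \<le> infsum ?b UNIV"
    by (rule infsum_mono[OF _ b(1)]) (rule le)
  also have "\<dots> < \<epsilon>\<^sup>2"
  proof -
    have "0 < \<epsilon>\<^sup>2"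
      using \<epsilon> by simp
    then show ?thesis
      using b(2) A(1) by linarith
  qed
  finally have "ell2_norm (\<lambda>x. g x - (\<Sum>i\<in>A. c i * e i x)) < \<epsilon>"
    unfolding ell2_norm_def using \<epsilon> by (intro real_less_lsqrt infsum_nonneg) auto
  then show "\<exists>A c. finite A \<and> ell2_norm (\<lambda>x. g x - (\<Sum>i\<in>A. c i * e i x)) < \<epsilon>"
    using A(2) by blast
qed (use e on in auto)

section \<open>Translates under the semidirect product\<close>

lemma infsum_prod_finite:
  fixes F :: "'n \<times> 'h::finite \<Rightarrow> complex"
  assumes "F summable_on UNIV"
  shows "infsum F UNIV = (\<Sum>h\<in>UNIV. \<Sum>\<^sub>\<infinity>n. F (n, h))"
proof -
  have "infsum F (range (\<lambda>n. (n, h))) = (\<Sum>\<^sub>\<infinity>n. F (n, h))" for h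
    by (subst infsum_reindex) (auto simp: inj_on_def o_def)
  moreover have "(\<Sum>h\<in>UNIV. infsum F (range (\<lambda>n. (n, h)))) = infsum F (\<Union>h\<in>UNIV. range (\<lambda>n. (n, h)))"
    by (rule sum_infsum) (auto intro: summable_on_subset_banach[OF assms])
  moreover have "(\<Union>h\<in>UNIV. range (\<lambda>n. (n, h))) = (UNIV :: ('n \<times> 'h) set)"
    by auto
  ultimately show ?thesis
    by simp
qed

lemma ell2_reindex:
  assumes "f \<in> ell2" "inj p"
  shows "(\<lambda>x. f (p x)) \<in> ell2"
proof -
  have "(\<lambda>x. (cmod (f x))\<^sup>2) summable_on range p"
    using assms(1) unfolding ell2_def by (auto intro: summable_on_subset_banach)
  then show ?thesis
    unfolding ell2_def using summable_on_reindex[OF assms(2), of "\<lambda>x. (cmod (f x))\<^sup>2"] by (simp add: o_def)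
qed

context
  fixes \<sigma> :: "'h::{group_add,finite} \<Rightarrow> 'n::ab_group_add \<Rightarrow> 'n"
  assumes \<sigma>: "aut_action \<sigma>"
begin

lemma sd_mult_left_cancel: "sd_mult \<sigma> \<gamma> \<eta> = sd_mult \<sigma> \<gamma> \<zeta> \<longleftrightarrow> \<eta> = \<zeta>"
  using sd_mult_assoc[OF \<sigma>] sd_mult_inv[OF \<sigma>] sd_mult_one[OF \<sigma>] by metis

lemma sd_inv_unique: "sd_mult \<sigma> \<gamma> \<eta> = (0, 0) \<Longrightarrow> \<eta> = sd_inv \<sigma> \<gamma>"
  using sd_mult_left_cancel sd_mult_inv(2)[OF \<sigma>] by metis

lemma sd_inv_inv: "sd_inv \<sigma> (sd_inv \<sigma> \<gamma>) = \<gamma>"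
  using sd_inv_unique sd_mult_inv(1)[OF \<sigma>] by metis

lemma sd_inv_mult: "sd_inv \<sigma> (sd_mult \<sigma> \<gamma> \<eta>) = sd_mult \<sigma> (sd_inv \<sigma> \<eta>) (sd_inv \<sigma> \<gamma>)"
proof -
  have "sd_mult \<sigma> (sd_mult \<sigma> \<gamma> \<eta>) (sd_mult \<sigma> (sd_inv \<sigma> \<eta>) (sd_inv \<sigma> \<gamma>))
      = sd_mult \<sigma> (sd_mult \<sigma> \<gamma> (sd_mult \<sigma> \<eta> (sd_inv \<sigma> \<eta>))) (sd_inv \<sigma> \<gamma>)"
    by (simp only: sd_mult_assoc[OF \<sigma>])
  then show ?thesis
    using sd_inv_unique by (simp add: sd_mult_inv[OF \<sigma>] sd_mult_one[OF \<sigma>])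
qed

lemma bij_sd_mult: "bij (sd_mult \<sigma> \<gamma>)"
proof (rule bijI)
  show "inj (sd_mult \<sigma> \<gamma>)"
    using sd_mult_left_cancel by (simp add: inj_def)
  have "\<eta> = sd_mult \<sigma> \<gamma> (sd_mult \<sigma> (sd_inv \<sigma> \<gamma>) \<eta>)" for \<eta>
    by (simp add: sd_mult_assoc[OF \<sigma>, symmetric] sd_mult_inv[OF \<sigma>] sd_mult_one[OF \<sigma>])
  then show "surj (sd_mult \<sigma> \<gamma>)"
    unfolding surj_def by blast
qed

text \<open>Solving for \<open>\<gamma>\<close> gives \<open>\<eta>\<close> times the inverse of
  \<open>\<zeta>\<close>, which is the witness.\<close>

lemma bij_sd_inv_mult: "bij (\<lambda>\<gamma>. sd_mult \<sigma> (sd_inv \<sigma> \<gamma>) \<eta>)"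
proof (rule bij_betw_byWitness[where f' = "\<lambda>\<zeta>. sd_mult \<sigma> \<eta> (sd_inv \<sigma> \<zeta>)"])
  show "\<forall>\<gamma>\<in>UNIV. sd_mult \<sigma> \<eta> (sd_inv \<sigma> (sd_mult \<sigma> (sd_inv \<sigma> \<gamma>) \<eta>)) = \<gamma>"
    by (simp add: sd_inv_mult sd_inv_inv sd_mult_assoc[OF \<sigma>, symmetric] sd_mult_inv[OF \<sigma>] sd_mult_one[OF \<sigma>])
  show "\<forall>\<zeta>\<in>UNIV. sd_mult \<sigma> (sd_inv \<sigma> (sd_mult \<sigma> \<eta> (sd_inv \<sigma> \<zeta>))) \<eta> = \<zeta>"
    by (simp add: sd_inv_mult sd_inv_inv sd_mult_assoc[OF \<sigma>] sd_mult_inv[OF \<sigma>] sd_mult_one[OF \<sigma>])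
qed auto

section \<open>The left regular representation: unitarity and completeness\<close>

lemma left_regular_apply:
  "left_regular \<sigma> (m, l) f (n, h) = f (sd_mult \<sigma> (sd_inv \<sigma> (0, l)) (n - m, h))"
  unfolding left_regular_def sd_mult_def sd_inv_def
  by (simp add: aut_action_add(1)[OF \<sigma>, symmetric] aut_action_map_zero[OF \<sigma>])

lemma left_regular_zero: "left_regular \<sigma> (0, 0) f = f"
  using sd_inv_unique[of "(0, 0)" "(0, 0)"] unfolding left_regular_def
  by (simp add: sd_mult_one[OF \<sigma>])

lemma left_regular_ell2: "f \<in> ell2 \<Longrightarrow> left_regular \<sigma> \<gamma> f \<in> ell2"
  unfolding left_regular_def by (rule ell2_reindex[OF _ bij_is_inj[OF bij_sd_mult]])

text \<open>Left multiplication by \<open>\<gamma>\<close> permutes the group, so it can be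
  substituted in the sum.\<close>

lemma left_regular_inner:
  "ell2_inner (left_regular \<sigma> \<gamma> f) (left_regular \<sigma> \<eta> f)
    = ell2_inner f (left_regular \<sigma> (sd_mult \<sigma> (sd_inv \<sigma> \<gamma>) \<eta>) f)"
proof -
  let ?G = "\<lambda>x. left_regular \<sigma> \<gamma> f x * cnj (left_regular \<sigma> \<eta> f x)"
  have G: "ell2_inner (left_regular \<sigma> \<gamma> f) (left_regular \<sigma> \<eta> f) = (\<Sum>\<^sub>\<infinity>x. ?G (sd_mult \<sigma> \<gamma> x))"
    unfolding ell2_inner_def by (rule infsum_reindex_bij_betw[OF bij_sd_mult, symmetric])
  have "?G (sd_mult \<sigma> \<gamma> x) = f x * cnj (left_regular \<sigma> (sd_mult \<sigma> (sd_inv \<sigma> \<gamma>) \<eta>) f x)" for x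
  proof -
    have "sd_mult \<sigma> (sd_inv \<sigma> \<gamma>) (sd_mult \<sigma> \<gamma> x) = x"
      by (simp add: sd_mult_assoc[OF \<sigma>, symmetric] sd_mult_inv[OF \<sigma>] sd_mult_one[OF \<sigma>])
    moreover have "sd_mult \<sigma> (sd_inv \<sigma> \<eta>) (sd_mult \<sigma> \<gamma> x)
        = sd_mult \<sigma> (sd_inv \<sigma> (sd_mult \<sigma> (sd_inv \<sigma> \<gamma>) \<eta>)) x"
      by (simp add: sd_inv_mult sd_inv_inv sd_mult_assoc[OF \<sigma>])
    ultimately show ?thesis
      unfolding left_regular_def by simp
  qed
  then show ?thesis
    unfolding G ell2_inner_def[of f] by (simp only:)
qed

lemma left_regular_orthonormal_iff:
  "(\<forall>\<gamma> \<eta>. ell2_inner (left_regular \<sigma> \<gamma> f) (left_regular \<sigma> \<eta> f) = (if \<gamma> = \<eta> then 1 else 0)) \<longleftrightarrow>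
   (\<forall>\<gamma>. ell2_inner f (left_regular \<sigma> \<gamma> f) = (if \<gamma> = (0, 0) then 1 else 0))" (is "?L \<longleftrightarrow> ?R")
proof
  assume ?L
  then have "ell2_inner (left_regular \<sigma> (0, 0) f) (left_regular \<sigma> \<gamma> f) = (if (0, 0) = \<gamma> then 1 else 0)" for \<gamma>
    by blast
  then show ?R
    unfolding left_regular_zero by auto
next
  assume R: ?R
  have eq: "sd_mult \<sigma> (sd_inv \<sigma> \<gamma>) \<eta> = (0, 0) \<longleftrightarrow> \<gamma> = \<eta>" for \<gamma> \<eta>
    using sd_inv_unique[of "sd_inv \<sigma> \<gamma>" \<eta>] sd_mult_inv(1)[OF \<sigma>, of \<gamma>] by (auto simp: sd_inv_inv)
  show ?L
    unfolding left_regular_inner using R by (simp only: eq simp_thms)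
qed

lemma left_regular_basis_iff:
  assumes f: "f \<in> ell2"
  shows "ell2_orthonormal_basis (\<lambda>\<gamma>. left_regular \<sigma> \<gamma> f) \<longleftrightarrow>
    (\<forall>\<gamma> \<eta>. ell2_inner (left_regular \<sigma> \<gamma> f) (left_regular \<sigma> \<eta> f) = (if \<gamma> = \<eta> then 1 else 0))"
proof
  assume on: "\<forall>\<gamma> \<eta>. ell2_inner (left_regular \<sigma> \<gamma> f) (left_regular \<sigma> \<eta> f) = (if \<gamma> = \<eta> then 1 else 0)"
  then have "ell2_inner f f = 1"
    unfolding left_regular_orthonormal_iff using left_regular_zero by metis
  then have "((\<lambda>x. complex_of_real ((cmod (f x))\<^sup>2)) has_sum complex_of_real 1) UNIV"
    using ell2_inner_has_sum[OF f f] unfolding complex_norm_square by simp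
  then have "((\<lambda>x. (cmod (f x))\<^sup>2) has_sum 1) UNIV"
    unfolding has_sum_of_real_iff .
  then have "((\<lambda>\<gamma>. (cmod (left_regular \<sigma> \<gamma> f y))\<^sup>2) has_sum 1) UNIV" for y
    unfolding left_regular_def
    using has_sum_reindex_bij_betw[OF bij_sd_inv_mult[of y], of "\<lambda>x. (cmod (f x))\<^sup>2" 1] by simp
  then show "ell2_orthonormal_basis (\<lambda>\<gamma>. left_regular \<sigma> \<gamma> f)"
    by (rule ell2_orthonormal_basisI[OF left_regular_ell2[OF f] on[rule_format]])
qed (simp add: ell2_orthonormal_basis_def)

section \<open>Inner products of translates as Fourier coefficients\<close>

lemma transfer_entry_ell2:
  assumes "f \<in> ell2"
  shows "(\<lambda>n. f (sd_mult \<sigma> (sd_inv \<sigma> (0, l)) (n, h))) \<in> ell2"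
proof (rule ell2_reindex[OF assms])
  show "inj (\<lambda>n. sd_mult \<sigma> (sd_inv \<sigma> (0, l)) (n, h))"
    using sd_mult_left_cancel by (simp add: inj_def)
qed

text \<open>The factor \<open>\<xi> m\<close> is absorbed into \<open>F \<xi> $ h $ l\<close> as a
  translation, Parseval is applied for each row \<open>h\<close>, and the finite sum over
  \<open>h\<close> reassembles the sum over the whole group.\<close>

lemma left_regular_inner_integral:
  assumes haar: "normalized_haar_dual \<mu>" and f: "f \<in> ell2"
  defines "F \<equiv> transfer_matrix \<mu> \<sigma> f"
  shows "integrable \<mu> (\<lambda>\<xi>. (conj_transpose (F \<xi>) ** F \<xi>) $ k $ l)"
    and "(\<integral>\<xi>. (conj_transpose (F \<xi>) ** F \<xi>) $ k $ l * \<xi> m \<partial>\<mu>)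
      = ell2_inner (left_regular \<sigma> (0, l) f) (left_regular \<sigma> (m, k) f)"
proof -
  interpret dual_haar \<mu>
    by standard (rule haar)
  let ?a = "\<lambda>l h n. f (sd_mult \<sigma> (sd_inv \<sigma> (0, l)) (n, h))"
  have a: "?a l h \<in> ell2" for l h
    by (rule transfer_entry_ell2[OF f])
  have four: "is_fourier \<mu> (?a l h) (\<lambda>\<xi>. F \<xi> $ h $ l)" for l h
    unfolding F_def transfer_matrix_def using is_fourier_fourier[OF a] by simp
  have sq: "square_integrable \<mu> (\<lambda>\<xi>. F \<xi> $ h $ l * \<xi> m)" "square_integrable \<mu> (\<lambda>\<xi>. F \<xi> $ h $ l)" for h l m
    using four is_fourier_translate[OF four] unfolding is_fourier_def by blast+
  have entry: "(conj_transpose (F \<xi>) ** F \<xi>) $ k $ l = (\<Sum>h\<in>UNIV. F \<xi> $ h $ l * cnj (F \<xi> $ h $ k))" for \<xi> k l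
    unfolding conj_transpose_def matrix_matrix_mult_def by (simp add: mult.commute)
  show "integrable \<mu> (\<lambda>\<xi>. (conj_transpose (F \<xi>) ** F \<xi>) $ k $ l)"
    unfolding entry by (intro Bochner_Integration.integrable_sum integrable_mult_cnj sq)
  have "(\<integral>\<xi>. (conj_transpose (F \<xi>) ** F \<xi>) $ k $ l * \<xi> m \<partial>\<mu>)
      = (\<integral>\<xi>. (\<Sum>h\<in>UNIV. F \<xi> $ h $ l * \<xi> m * cnj (F \<xi> $ h $ k)) \<partial>\<mu>)"
    unfolding entry by (rule arg_cong[where f = "integral\<^sup>L \<mu>"]) (simp add: sum_distrib_left mult_ac)
  also have "\<dots> = (\<Sum>h\<in>UNIV. \<integral>\<xi>. F \<xi> $ h $ l * \<xi> m * cnj (F \<xi> $ h $ k) \<partial>\<mu>)"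
    by (intro Bochner_Integration.integral_sum integrable_mult_cnj sq)
  also have "\<dots> = (\<Sum>h\<in>UNIV. \<Sum>\<^sub>\<infinity>n. ?a l h (n + m) * cnj (?a k h n))"
    by (intro sum.cong refl parseval is_fourier_translate four a ell2_reindex[of "?a l h" "\<lambda>n. n + m" for h]) 
      (auto simp: inj_def)
  \<comment> \<open>Substituting \<open>n - m\<close> moves the translation onto the second factor,
    where it has the form given by \<open>left_regular_apply\<close>.\<close>
  also have "\<dots> = (\<Sum>h\<in>UNIV. \<Sum>\<^sub>\<infinity>n. ?a l h n * cnj (?a k h (n - m)))"
  proof (rule sum.cong[OF refl])
    fix h
    show "(\<Sum>\<^sub>\<infinity>n. ?a l h (n + m) * cnj (?a k h n)) = (\<Sum>\<^sub>\<infinity>n. ?a l h n * cnj (?a k h (n - m)))"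
      by (rule infsum_reindex_bij_witness[where j = "\<lambda>n. n + m" and i = "\<lambda>n. n - m"]) auto
  qed
  also have "\<dots> = (\<Sum>h\<in>UNIV. \<Sum>\<^sub>\<infinity>n. left_regular \<sigma> (0, l) f (n, h) * cnj (left_regular \<sigma> (m, k) f (n, h)))"
    by (simp add: left_regular_apply)
  also have "\<dots> = ell2_inner (left_regular \<sigma> (0, l) f) (left_regular \<sigma> (m, k) f)"
    unfolding ell2_inner_def
    by (rule infsum_prod_finite[symmetric]) (intro ell2_mult_cnj_summable left_regular_ell2 f)
  finally show "(\<integral>\<xi>. (conj_transpose (F \<xi>) ** F \<xi>) $ k $ l * \<xi> m \<partial>\<mu>)
      = ell2_inner (left_regular \<sigma> (0, l) f) (left_regular \<sigma> (m, k) f)" .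
qed

text \<open>The identity of \<open>H\<close> contributes no translation, so
  \<open>fourier_vector\<close> is the column of the transfer matrix at index \<open>0\<close>, and
  applying the conjugate transpose to it yields that column of the product.\<close>

lemma transfer_matrix_first_column:
  "conj_transpose (transfer_matrix \<mu> \<sigma> f \<xi>) *v fourier_vector \<mu> f \<xi> = axis 0 1 \<longleftrightarrow>
    (\<forall>k. (conj_transpose (transfer_matrix \<mu> \<sigma> f \<xi>) ** transfer_matrix \<mu> \<sigma> f \<xi>) $ k $ 0 = (if k = 0 then 1 else 0))"
proof -
  have "sd_inv \<sigma> (0, 0) = (0, 0)"
    using sd_inv_unique sd_mult_one(1)[OF \<sigma>] by metis
  then have "fourier_vector \<mu> f \<xi> $ h = transfer_matrix \<mu> \<sigma> f \<xi> $ h $ 0" for h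
    unfolding fourier_vector_def transfer_matrix_def by (simp add: sd_mult_one[OF \<sigma>])
  then have "(conj_transpose (transfer_matrix \<mu> \<sigma> f \<xi>) *v fourier_vector \<mu> f \<xi>) $ k
      = (conj_transpose (transfer_matrix \<mu> \<sigma> f \<xi>) ** transfer_matrix \<mu> \<sigma> f \<xi>) $ k $ 0" for k
    by (simp only: matrix_vector_mult_def matrix_matrix_mult_def vec_lambda_beta)
  then show ?thesis
    by (simp only: vec_eq_iff axis_def vec_lambda_beta)
qed

end

theorem corollary7:
  fixes \<sigma> :: "'h::{group_add,finite} \<Rightarrow> 'n::ab_group_add \<Rightarrow> 'n"
    and \<mu> :: "('n \<Rightarrow> complex) measure"
    and f :: "'n \<times> 'h \<Rightarrow> complex"
  assumes "aut_action \<sigma>"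
    and "normalized_haar_dual \<mu>"
    and "f \<in> ell2"
  shows "(ell2_orthonormal_basis (\<lambda>\<gamma>. left_regular \<sigma> \<gamma> f) \<longleftrightarrow>
            (AE \<xi> in \<mu>. unitary_matrix (transfer_matrix \<mu> \<sigma> f \<xi>))) \<and>
         (ell2_orthonormal_basis (\<lambda>\<gamma>. left_regular \<sigma> \<gamma> f) \<longleftrightarrow>
            (AE \<xi> in \<mu>. conj_transpose (transfer_matrix \<mu> \<sigma> f \<xi>) *v fourier_vector \<mu> f \<xi> = axis 0 1))"
proof -
  interpret dual_haar \<mu>
    by standard (rule assms(2))
  define F where "F = transfer_matrix \<mu> \<sigma> f"
  define P where "P \<xi> = conj_transpose (F \<xi>) ** F \<xi>" for \<xi>
  let ?L = "\<lambda>\<gamma>. left_regular \<sigma> \<gamma> f"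
  let ?basis = "ell2_orthonormal_basis ?L"
  let ?unitary = "AE \<xi> in \<mu>. unitary_matrix (F \<xi>)"
  let ?column = "AE \<xi> in \<mu>. conj_transpose (F \<xi>) *v fourier_vector \<mu> f \<xi> = axis 0 1"
  have int: "integrable \<mu> (\<lambda>\<xi>. P \<xi> $ k $ l)"
    and inner: "(\<integral>\<xi>. P \<xi> $ k $ l * \<xi> m \<partial>\<mu>) = ell2_inner (?L (0, l)) (?L (m, k))" for k l m
    unfolding P_def F_def using left_regular_inner_integral[OF assms] by blast+
  have column: "?column \<longleftrightarrow> (AE \<xi> in \<mu>. \<forall>k. P \<xi> $ k $ 0 = (if k = 0 then 1 else 0))"
    unfolding F_def P_def transfer_matrix_first_column[OF assms(1)] ..
  \<comment> \<open>A one-sided inverse of a square matrix is two-sided.\<close>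
  have unitary: "unitary_matrix (F \<xi>) \<longleftrightarrow> P \<xi> = mat 1" for \<xi>
    unfolding unitary_matrix_def P_def using matrix_left_right_inverse by blast
  have "?unitary" if ?basis
  proof -
    \<comment> \<open>Orthonormality says that this entry has the Fourier coefficients of the
      constant 1 or 0: for \<open>k = l\<close> the pair \<open>(m, k)\<close> equals
      \<open>(0, l)\<close> only at \<open>m = 0\<close>.\<close>
    have "AE \<xi> in \<mu>. P \<xi> $ k $ l - (if k = l then 1 else 0) = 0" for k l
    proof (rule annihilates_chars_AE_zero)
      have "(\<integral>\<xi>. (P \<xi> $ k $ l - (if k = l then 1 else 0)) * \<xi> m \<partial>\<mu>) = 0" for m
      proof -
        have "(\<integral>\<xi>. (P \<xi> $ k $ l - (if k = l then 1 else 0)) * \<xi> m \<partial>\<mu>)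
            = (\<integral>\<xi>. P \<xi> $ k $ l * \<xi> m - (if k = l then 1 else 0) * \<xi> m \<partial>\<mu>)"
          by (simp only: left_diff_distrib)
        also have "\<dots> = (\<integral>\<xi>. P \<xi> $ k $ l * \<xi> m \<partial>\<mu>) - (\<integral>\<xi>. (if k = l then 1 else 0) * \<xi> m \<partial>\<mu>)"
          using integrable_mult_char[OF int, of m k l]
          by (intro Bochner_Integration.integral_diff integrable_mult_right integrable_coordinate)
            (simp add: mult.commute)
        also have "\<dots> = 0"
        proof -
          have "ell2_inner (?L (0, l)) (?L (m, k)) = (if (0, l) = (m, k) then 1 else 0)"
            by (rule that[unfolded left_regular_basis_iff[OF assms(1,3)], rule_format])
          then show ?thesis
            unfolding inner by (cases "k = l"; cases "m = 0") (simp_all add: integral_coordinate)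
        qed
        finally show ?thesis .
      qed
      then show "annihilates_chars (\<lambda>\<xi>. P \<xi> $ k $ l - (if k = l then 1 else 0))"
        unfolding annihilates_chars_def using int by simp
    qed
    \<comment> \<open>There are finitely many entries, so their exceptional null sets can be
      united.\<close>
    then have "AE \<xi> in \<mu>. \<forall>k\<in>UNIV. \<forall>l\<in>UNIV. P \<xi> $ k $ l - (if k = l then 1 else 0) = 0"
      by (intro AE_finite_allI finite)
    then show ?unitary
    proof eventually_elim
      case (elim \<xi>)
      then have "P \<xi> $ k $ l = mat 1 $ k $ l" for k l
        by (simp add: mat_def)
      then show ?case
        unfolding unitary vec_eq_iff by blast
    qed
  qed
  moreover have ?column if ?unitary
    using that unfolding column unitary by eventually_elim (simp add: mat_def)
  moreover have ?basis if ?column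
  proof -
    \<comment> \<open>Index \<open>0\<close> of the column is the untranslated \<open>f\<close>, so
      these coefficients give the inner products of \<open>f\<close> with every translate.\<close>
    have "ell2_inner f (?L (m, k)) = (if (m, k) = (0, 0) then 1 else 0)" for m k
    proof -
      have "ell2_inner f (?L (m, k)) = (\<integral>\<xi>. P \<xi> $ k $ 0 * \<xi> m \<partial>\<mu>)"
        unfolding inner left_regular_zero[OF assms(1)] ..
      also have "\<dots> = (\<integral>\<xi>. (if k = 0 then 1 else 0) * \<xi> m \<partial>\<mu>)"
      proof (rule integral_cong_AE)
        show "(\<lambda>\<xi>. P \<xi> $ k $ 0 * \<xi> m) \<in> borel_measurable \<mu>"
          using int by (intro borel_measurable_times coordinate_measurable) auto
        show "AE \<xi> in \<mu>. P \<xi> $ k $ 0 * \<xi> m = (if k = 0 then 1 else 0) * \<xi> m"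
          using that unfolding column by eventually_elim simp
      qed simp
      also have "\<dots> = (if (m, k) = (0, 0) then 1 else 0)"
        by (cases "k = 0") (simp_all add: integral_coordinate)
      finally show ?thesis .
    qed
    then show ?basis
      unfolding left_regular_basis_iff[OF assms(1,3)] left_regular_orthonormal_iff[OF assms(1)]
      unfolding split_paired_All by (intro allI)
  qed
  ultimately show ?thesis
    unfolding F_def by blast
qed

end
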